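(* Let $G=\mathbb{Z}\wr(\mathbb{Z}\wr\mathbb{Z})$, a solvable group of class 3, equipped with the word metric of a finite generating set. For some exponential function $D$ (i.e. $D(\lambda)=e^{\alpha\lambda}$ for some constant $\alpha>0$) the $D$-controlled dimension growth of $G$ is exponential, i.e. the function $\lambda\mapsto d_{D,G}(\lambda)=(\lambda,D(\lambda))\text{-dim}(G)$ has the same growth as $e^{\lambda}$.
   Context: For groups $A,B$, the (restricted) wreath product $B\wr A$ is the semidirect product $B^{(A)}\rtimes A$, where $B^{(A)}$ is the group of finitely supported functions $A\to B$ and $A$ acts on it by translation of the argument. Let $X$ be a metric space and $\lambda>0$. Two points $x,y$ of a set are $\lambda$-connected in it if there is a finite sequence of points of the set from $x$ to $y$ with consecutive distances at most $\lambda$; a set is a $\lambda$-cluster if every two of its points are $\lambda$-connected in it. For $\lambda,D>0$ we say $(\lambda,D)\text{-dim}(X)\le n$ if the points of $X$ can be colored in at most $n+1$ colors so that every monochromatic $\lambda$-cluster has diameter at most $D$; $(\lambda,D)\text{-dim}(X)$ is the smallest such $n$ ($\infty$ if there is none). For a function $D=D(\lambda)$ put $d_{D,X}(\lambda)=(\lambda,D(\lambda))\text{-dim}(X)$; its growth is the $D$-controlled dimension growth of $X$. Two functions $f,g$ on the positive reals have the same growth if there are constants $a,c>0$ with $f(at)\ge g(t)-c$ and $g(at)\ge f(t)-c$ for all $t$. *)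

theory Defs
  imports
    "HOL-Analysis.Analysis"
    "HOL-Algebra.Product_Groups"
    "HOL-Algebra.Elementary_Groups"
    "HOL-Algebra.Solvable_Groups"
begin

section \<open>Wreath products\<close>

definition semidirect_product ::
  "('n, 'x) monoid_scheme \<Rightarrow> ('h, 'y) monoid_scheme \<Rightarrow> ('h \<Rightarrow> 'n \<Rightarrow> 'n) \<Rightarrow> ('n \<times> 'h) monoid"
  where
  "semidirect_product N H act =
     \<lparr> carrier = carrier N \<times> carrier H,
       monoid.mult = (\<lambda>(m, a) (n, b). (m \<otimes>\<^bsub>N\<^esub> act a n, a \<otimes>\<^bsub>H\<^esub> b)),
       one = (\<one>\<^bsub>N\<^esub>, \<one>\<^bsub>H\<^esub>) \<rparr>"

definition translation ::
  "('a, 'x) monoid_scheme \<Rightarrow> 'a \<Rightarrow> ('a \<Rightarrow> 'b) \<Rightarrow> ('a \<Rightarrow> 'b)"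
  where
  "translation A a f = (\<lambda>x\<in>carrier A. f (inv\<^bsub>A\<^esub> a \<otimes>\<^bsub>A\<^esub> x))"

text \<open>
  The restricted wreath product of \<open>B\<close> (base) by \<open>A\<close> (acting group). Elements of
  \<^const>\<open>sum_group\<close> are finitely supported functions that are \<^const>\<open>undefined\<close> off the carrier.
\<close>

definition wreath_product ::
  "('b, 'x) monoid_scheme \<Rightarrow> ('a, 'y) monoid_scheme \<Rightarrow> (('a \<Rightarrow> 'b) \<times> 'a) monoid"
  where
  "wreath_product B A =
     semidirect_product (sum_group (carrier A) (\<lambda>_. B)) A (translation A)"

lemma translation_closed:
  assumes A: "group A" and B: "group B" and a: "a \<in> carrier A"
    and f: "f \<in> carrier (sum_group (carrier A) (\<lambda>_. B))"
  shows "translation A a f \<in> carrier (sum_group (carrier A) (\<lambda>_. B))"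
proof -
  interpret A: group A by fact
  have f': "f \<in> (\<Pi>\<^sub>E i\<in>carrier A. carrier B)" "finite {i \<in> carrier A. f i \<noteq> \<one>\<^bsub>B\<^esub>}"
    using f by (auto simp: carrier_sum_group B)
  have "{i \<in> carrier A. f (inv\<^bsub>A\<^esub> a \<otimes>\<^bsub>A\<^esub> i) \<noteq> \<one>\<^bsub>B\<^esub>}
      \<subseteq> (\<lambda>i. a \<otimes>\<^bsub>A\<^esub> i) ` {i \<in> carrier A. f i \<noteq> \<one>\<^bsub>B\<^esub>}"
  proof
    fix i assume i: "i \<in> {i \<in> carrier A. f (inv\<^bsub>A\<^esub> a \<otimes>\<^bsub>A\<^esub> i) \<noteq> \<one>\<^bsub>B\<^esub>}"
    then have "i = a \<otimes>\<^bsub>A\<^esub> (inv\<^bsub>A\<^esub> a \<otimes>\<^bsub>A\<^esub> i)"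
      using a by (simp add: A.m_assoc[symmetric])
    then show "i \<in> (\<lambda>i. a \<otimes>\<^bsub>A\<^esub> i) ` {i \<in> carrier A. f i \<noteq> \<one>\<^bsub>B\<^esub>}"
      using i a by blast
  qed
  then have "finite {i \<in> carrier A. f (inv\<^bsub>A\<^esub> a \<otimes>\<^bsub>A\<^esub> i) \<noteq> \<one>\<^bsub>B\<^esub>}"
    using f'(2) finite_surj by blast
  then have "finite {i \<in> carrier A. translation A a f i \<noteq> \<one>\<^bsub>B\<^esub>}"
    by (simp add: translation_def cong: conj_cong)
  then show ?thesis
    using f'(1) a by (auto simp: carrier_sum_group B translation_def PiE_iff)
qed

lemma group_wreath_product:
  assumes A: "group A" and B: "group B"
  shows "group (wreath_product B A)"
proof -
  interpret A: group A by fact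
  interpret B: group B by fact
  let ?N = "sum_group (carrier A) (\<lambda>_. B)"
  have N: "group ?N" by (simp add: B)
  interpret N: group ?N by fact
  have inN: "f x \<in> carrier B" if "f \<in> carrier ?N" "x \<in> carrier A" for f x
    using that by (auto simp: carrier_sum_group B)
  have hom: "translation A a (f \<otimes>\<^bsub>?N\<^esub> g) = translation A a f \<otimes>\<^bsub>?N\<^esub> translation A a g"
    if "a \<in> carrier A" for a f g
    using that by (auto simp: translation_def fun_eq_iff)
  have comp: "translation A a (translation A b f) = translation A (a \<otimes>\<^bsub>A\<^esub> b) f"
    if "a \<in> carrier A" "b \<in> carrier A" for a b and f :: "'a \<Rightarrow> 'c"
    using that by (auto simp: translation_def fun_eq_iff A.inv_mult_group A.m_assoc)
  have one: "translation A \<one>\<^bsub>A\<^esub> f = f" if "f \<in> carrier ?N" for f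
    using that by (auto simp: translation_def fun_eq_iff carrier_sum_group B PiE_iff extensional_def)
  have t1: "translation A a \<one>\<^bsub>?N\<^esub> = \<one>\<^bsub>?N\<^esub>" if "a \<in> carrier A" for a
    using that by (auto simp: translation_def fun_eq_iff)
  note cl = translation_closed[OF A B]
  have carr: "carrier (wreath_product B A) = carrier ?N \<times> carrier A"
    and mul: "\<And>m a n b. (m, a) \<otimes>\<^bsub>wreath_product B A\<^esub> (n, b)
       = (m \<otimes>\<^bsub>?N\<^esub> translation A a n, a \<otimes>\<^bsub>A\<^esub> b)"
    and on: "\<one>\<^bsub>wreath_product B A\<^esub> = (\<one>\<^bsub>?N\<^esub>, \<one>\<^bsub>A\<^esub>)"
    by (simp_all add: wreath_product_def semidirect_product_def del: mult_sum_group one_sum_group)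
  note [simp del] = mult_sum_group one_sum_group inv_sum_group
  show ?thesis
  proof (rule groupI)
    fix x y z
    assume "x \<in> carrier (wreath_product B A)" "y \<in> carrier (wreath_product B A)"
      "z \<in> carrier (wreath_product B A)"
    then show "x \<otimes>\<^bsub>wreath_product B A\<^esub> y \<otimes>\<^bsub>wreath_product B A\<^esub> z
        = x \<otimes>\<^bsub>wreath_product B A\<^esub> (y \<otimes>\<^bsub>wreath_product B A\<^esub> z)"
      by (auto simp: carr mul hom comp cl A.m_assoc N.m_assoc)
  next
    fix x assume "x \<in> carrier (wreath_product B A)"
    then obtain f a where x: "x = (f, a)" "f \<in> carrier ?N" "a \<in> carrier A"
      by (auto simp: carr)
    let ?y = "(translation A (inv\<^bsub>A\<^esub> a) (inv\<^bsub>?N\<^esub> f), inv\<^bsub>A\<^esub> a)"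
    have "?y \<in> carrier (wreath_product B A)"
      using x N.inv_closed by (simp add: carr cl)
    moreover have "?y \<otimes>\<^bsub>wreath_product B A\<^esub> x = \<one>\<^bsub>wreath_product B A\<^esub>"
      using x by (simp add: mul on hom[symmetric] t1)
    ultimately show "\<exists>y\<in>carrier (wreath_product B A).
        y \<otimes>\<^bsub>wreath_product B A\<^esub> x = \<one>\<^bsub>wreath_product B A\<^esub>"
      by blast
  qed (auto simp: carr mul on one cl)
qed

abbreviation Z_wr_Z_wr_Z :: "(((int \<Rightarrow> int) \<times> int \<Rightarrow> int) \<times> ((int \<Rightarrow> int) \<times> int)) monoid"
  where
  "Z_wr_Z_wr_Z \<equiv>
     wreath_product integer_group (wreath_product integer_group integer_group)"

definition has_derived_length :: "('a, 'x) monoid_scheme \<Rightarrow> nat \<Rightarrow> bool"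
  where
  "has_derived_length G n \<longleftrightarrow>
     (derived G ^^ n) (carrier G) = {\<one>\<^bsub>G\<^esub>} \<and>
     (\<forall>m<n. (derived G ^^ m) (carrier G) \<noteq> {\<one>\<^bsub>G\<^esub>})"

section \<open>Word metrics\<close>

definition word_length :: "('a, 'x) monoid_scheme \<Rightarrow> 'a set \<Rightarrow> 'a \<Rightarrow> nat"
  where
  "word_length G S g =
     (LEAST n. \<exists>w. length w = n \<and> set w \<subseteq> S \<union> m_inv G ` S \<and>
                   foldr (\<otimes>\<^bsub>G\<^esub>) w \<one>\<^bsub>G\<^esub> = g)"

text \<open>
  The value \<open>0\<close> off the carrier is immaterial; it is there because \<^locale>\<open>Metric_space\<close> asks for
  symmetry on the whole type.
\<close>

definition word_dist :: "('a, 'x) monoid_scheme \<Rightarrow> 'a set \<Rightarrow> 'a \<Rightarrow> 'a \<Rightarrow> real"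
  where
  "word_dist G S x y =
     (if x \<in> carrier G \<and> y \<in> carrier G then real (word_length G S (inv\<^bsub>G\<^esub> x \<otimes>\<^bsub>G\<^esub> y)) else 0)"

context group
begin

lemma foldr_mult_closed: "set w \<subseteq> carrier G \<Longrightarrow> foldr (\<otimes>) w \<one> \<in> carrier G"
  by (induction w) auto

lemma foldr_mult_append:
  "set v \<subseteq> carrier G \<Longrightarrow> set w \<subseteq> carrier G \<Longrightarrow>
    foldr (\<otimes>) (v @ w) \<one> = foldr (\<otimes>) v \<one> \<otimes> foldr (\<otimes>) w \<one>"
  by (induction v) (auto simp: foldr_mult_closed m_assoc)

lemma foldr_mult_inv:
  "set w \<subseteq> carrier G \<Longrightarrow> foldr (\<otimes>) (rev (map (m_inv G) w)) \<one> = inv (foldr (\<otimes>) w \<one>)"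
proof (induction w)
  case (Cons a w)
  have "foldr (\<otimes>) (rev (map (m_inv G) w) @ [inv a]) \<one>
      = foldr (\<otimes>) (rev (map (m_inv G) w)) \<one> \<otimes> foldr (\<otimes>) [inv a] \<one>"
    using Cons.prems by (intro foldr_mult_append) auto
  then show ?case
    using Cons by (simp add: inv_mult_group foldr_mult_closed)
qed simp

lemma ex_word:
  assumes "g \<in> generate G S" "S \<subseteq> carrier G"
  shows "\<exists>w. set w \<subseteq> S \<union> m_inv G ` S \<and> foldr (\<otimes>) w \<one> = g"
  using assms(1)
proof (induction rule: generate.induct)
  case one
  show ?case by (rule exI[of _ "[]"]) simp
next
  case (incl h)
  then show ?case using assms by (intro exI[of _ "[h]"]) auto
next
  case (inv h)
  then show ?case using assms by (intro exI[of _ "[inv h]"]) auto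
next
  case (eng g h)
  then obtain v w where vw: "set v \<subseteq> S \<union> m_inv G ` S" "foldr (\<otimes>) v \<one> = g"
    "set w \<subseteq> S \<union> m_inv G ` S" "foldr (\<otimes>) w \<one> = h" by blast
  have "S \<union> m_inv G ` S \<subseteq> carrier G" using assms by auto
  then have "foldr (\<otimes>) (v @ w) \<one> = g \<otimes> h"
    using vw foldr_mult_append[of v w] by blast
  then show ?case using vw by (intro exI[of _ "v @ w"]) auto
qed

lemma Metric_space_word_dist:
  assumes S: "S \<subseteq> carrier G" and gen: "generate G S = carrier G"
  shows "Metric_space (carrier G) (word_dist G S)"
proof -
  let ?T = "S \<union> m_inv G ` S"
  have T: "?T \<subseteq> carrier G" using S by auto
  have word: "\<exists>w. length w = word_length G S g \<and> set w \<subseteq> ?T \<and> foldr (\<otimes>) w \<one> = g"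
    if g: "g \<in> carrier G" for g
  proof -
    obtain w where "set w \<subseteq> ?T" "foldr (\<otimes>) w \<one> = g"
      using ex_word[OF _ S, of g] gen g by auto
    then have "\<exists>n w. length w = n \<and> set w \<subseteq> ?T \<and> foldr (\<otimes>) w \<one> = g" by blast
    from LeastI_ex[OF this] show ?thesis unfolding word_length_def .
  qed
  have le: "word_length G S (foldr (\<otimes>) w \<one>) \<le> length w" if "set w \<subseteq> ?T" for w
    unfolding word_length_def using that by (intro Least_le) blast
  have inv_le: "word_length G S (inv g) \<le> word_length G S g" if g: "g \<in> carrier G" for g
  proof -
    obtain w where w: "length w = word_length G S g" "set w \<subseteq> ?T" "foldr (\<otimes>) w \<one> = g"
      using word[OF g] by blast
    have "set (rev (map (m_inv G) w)) \<subseteq> ?T"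
      using w(2) S by (force simp: image_iff)
    from le[OF this] show ?thesis
      using w foldr_mult_inv[of w] T by (simp add: subset_trans)
  qed
  have mult_le: "word_length G S (g \<otimes> h) \<le> word_length G S g + word_length G S h"
    if gh: "g \<in> carrier G" "h \<in> carrier G" for g h
  proof -
    obtain v w where vw: "length v = word_length G S g" "set v \<subseteq> ?T" "foldr (\<otimes>) v \<one> = g"
       "length w = word_length G S h" "set w \<subseteq> ?T" "foldr (\<otimes>) w \<one> = h"
      using word[OF gh(1)] word[OF gh(2)] by blast
    have "foldr (\<otimes>) (v @ w) \<one> = g \<otimes> h"
      using vw foldr_mult_append[of v w] T by (metis subset_trans)
    then show ?thesis using le[of "v @ w"] vw by simp
  qed
  show ?thesis
  proof
    fix x y
    show "0 \<le> word_dist G S x y" by (simp add: word_dist_def)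
    show "word_dist G S x y = word_dist G S y x"
    proof (cases "x \<in> carrier G \<and> y \<in> carrier G")
      case True
      then have "inv (inv x \<otimes> y) = inv y \<otimes> x" "inv (inv y \<otimes> x) = inv x \<otimes> y"
        by (simp_all add: inv_mult_group)
      then show ?thesis
        using inv_le[of "inv x \<otimes> y"] inv_le[of "inv y \<otimes> x"] True
        by (simp add: word_dist_def)
    qed (auto simp: word_dist_def)
  next
    fix x y assume xy: "x \<in> carrier G" "y \<in> carrier G"
    have "word_length G S \<one> = 0" using le[of "[]"] by simp
    moreover have "g = \<one>" if "g \<in> carrier G" "word_length G S g = 0" for g
      using word[of g] that by auto
    ultimately have "word_length G S (inv x \<otimes> y) = 0 \<longleftrightarrow> inv x \<otimes> y = \<one>"
      using xy by fastforce
    also have "\<dots> \<longleftrightarrow> x = y"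
      using xy by (metis inv_closed inv_equality inv_inv l_inv)
    finally show "word_dist G S x y = 0 \<longleftrightarrow> x = y"
      using xy by (simp add: word_dist_def)
  next
    fix x y z assume xyz: "x \<in> carrier G" "y \<in> carrier G" "z \<in> carrier G"
    have "inv x \<otimes> y \<otimes> (inv y \<otimes> z) = inv x \<otimes> z"
      using xyz by (metis inv_closed inv_solve_left m_assoc m_closed)
    then show "word_dist G S x z \<le> word_dist G S x y + word_dist G S y z"
      using mult_le[of "inv x \<otimes> y" "inv y \<otimes> z"] xyz by (simp add: word_dist_def)
  qed
qed

end

section \<open>Controlled dimension growth\<close>

text \<open>Throughout, \<open>d\<close> is a distance function and \<open>X\<close> the set of points of the space.\<close>

definition connected_at_scale :: "('a \<Rightarrow> 'a \<Rightarrow> real) \<Rightarrow> real \<Rightarrow> 'a set \<Rightarrow> 'a \<Rightarrow> 'a \<Rightarrow> bool"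
  where
  "connected_at_scale d lam C x y \<longleftrightarrow>
     (\<exists>p. p \<noteq> [] \<and> hd p = x \<and> last p = y \<and> set p \<subseteq> C \<and> successively (\<lambda>u v. d u v \<le> lam) p)"

definition cluster_at_scale :: "('a \<Rightarrow> 'a \<Rightarrow> real) \<Rightarrow> real \<Rightarrow> 'a set \<Rightarrow> bool"
  where
  "cluster_at_scale d lam C \<longleftrightarrow> (\<forall>x\<in>C. \<forall>y\<in>C. connected_at_scale d lam C x y)"

text \<open>
  Extended-valued, so that an unbounded set has diameter \<open>\<infinity>\<close>; the empty set gets \<open>-\<infinity>\<close>, which is
  harmless for upper bounds by positive reals.
\<close>

definition ediameter :: "('a \<Rightarrow> 'a \<Rightarrow> real) \<Rightarrow> 'a set \<Rightarrow> ereal"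
  where
  "ediameter d C = (SUP x\<in>C. SUP y\<in>C. ereal (d x y))"

definition controlled_dim_le ::
  "'a set \<Rightarrow> ('a \<Rightarrow> 'a \<Rightarrow> real) \<Rightarrow> real \<Rightarrow> real \<Rightarrow> nat \<Rightarrow> bool"
  where
  "controlled_dim_le X d lam D n \<longleftrightarrow>
     (\<exists>col :: 'a \<Rightarrow> nat. col ` X \<subseteq> {..<n + 1} \<and>
        (\<forall>C k. C \<subseteq> X \<and> (\<forall>x\<in>C. col x = k) \<and> cluster_at_scale d lam C \<longrightarrow>
               ediameter d C \<le> ereal D))"

text \<open>The infimum of the empty set in \<^typ>\<open>enat\<close> is \<open>\<infinity>\<close>.\<close>

definition controlled_dim :: "'a set \<Rightarrow> ('a \<Rightarrow> 'a \<Rightarrow> real) \<Rightarrow> real \<Rightarrow> real \<Rightarrow> enat"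
  where
  "controlled_dim X d lam D = Inf {enat n |n. controlled_dim_le X d lam D n}"

definition dim_growth_fun ::
  "(real \<Rightarrow> real) \<Rightarrow> 'a set \<Rightarrow> ('a \<Rightarrow> 'a \<Rightarrow> real) \<Rightarrow> real \<Rightarrow> enat"
  where
  "dim_growth_fun D X d lam = controlled_dim X d lam (D lam)"

definition same_growth :: "(real \<Rightarrow> ereal) \<Rightarrow> (real \<Rightarrow> ereal) \<Rightarrow> bool"
  where
  "same_growth f g \<longleftrightarrow>
     (\<exists>a>0. \<exists>c>0. \<forall>t>0. f (a * t) \<ge> g t - ereal c \<and> g (a * t) \<ge> f t - ereal c)"

end

theory Submission
  imports Defs
begin

text \<open>
  Upper bound: colour a locally finite space greedily so that points at distance at most \<open>\<lambda>\<close> get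
  different colours; the number of colours is the cardinality of a ball, hence exponential in \<open>\<lambda>\<close>.

  Lower bound: \<open>H = \<int> \<wr> \<int>\<close> has \<open>2 ^ r\<close> elements \<open>h\<close> whose lamps \<open>\<delta>\<^sub>h\<close> have length \<open>O(r)\<close> in
  \<open>G = \<int> \<wr> H\<close>, so \<open>G\<close> contains a cube \<open>{0,1}\<^sup>N\<close> with \<open>N = 2 ^ r\<close> in which flipping two coordinates
  is a move of length at most \<open>\<lambda> = O(r)\<close>, while word distance dominates Hamming distance up to a
  constant. A \<open>\<lambda>\<close>-cluster in the cube of Hamming radius at most \<open>k\<close> has at least \<open>(N - k) / (k + 1)\<close>
  times as many neighbours as points, and distinct \<open>\<lambda>\<close>-clusters of one colour share no neighbours.
  Therefore each colour class has density at most \<open>(k + 1) / (N - k)\<close>. Choosing \<open>\<alpha>\<close> so small that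
  \<open>exp (\<alpha> \<lambda>)\<close> is about the square root of \<open>N\<close> forces exponentially many colours.
\<close>

section \<open>Clusters and colourings\<close>

text \<open>Clusters map to clusters along \<open>f\<close> and the diameters agree, so the
  composite of \<open>col\<close> with \<open>f\<close> works. This restricts a colouring of the
  group to the embedded cube.\<close>

lemma controlled_dim_le_pullback:
  assumes "controlled_dim_le X d lam D n" and "f ` Y \<subseteq> X"
  shows "controlled_dim_le Y (\<lambda>u v. d (f u) (f v)) lam D n"
proof -
  obtain col :: "'a \<Rightarrow> nat" where col: "col ` X \<subseteq> {..<n + 1}"
    and diam: "\<forall>C k. C \<subseteq> X \<and> (\<forall>x\<in>C. col x = k) \<and> cluster_at_scale d lam C \<longrightarrow>
                 ediameter d C \<le> ereal D"
    using assms(1) unfolding controlled_dim_le_def by (elim exE conjE)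
  have "ediameter (\<lambda>u v. d (f u) (f v)) C \<le> ereal D"
    if C: "C \<subseteq> Y" "\<forall>x\<in>C. col (f x) = k" "cluster_at_scale (\<lambda>u v. d (f u) (f v)) lam C" for C k
  proof -
    have "connected_at_scale d lam (f ` C) (f u) (f v)" if uv: "u \<in> C" "v \<in> C" for u v
    proof -
      obtain p where "p \<noteq> []" "hd p = u" "last p = v" "set p \<subseteq> C"
        "successively (\<lambda>u v. d (f u) (f v) \<le> lam) p"
        using C(3) uv unfolding cluster_at_scale_def connected_at_scale_def by blast
      then show ?thesis
        unfolding connected_at_scale_def
        by (intro exI[of _ "map f p"]) (auto simp: hd_map last_map successively_map)
    qed
    then have "cluster_at_scale d lam (f ` C)"
      unfolding cluster_at_scale_def by blast
    then have "ediameter d (f ` C) \<le> ereal D"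
      using C assms(2) by (intro diam[rule_format, of _ k]) auto
    then show ?thesis
      by (simp add: ediameter_def image_image)
  qed
  then show ?thesis
    unfolding controlled_dim_le_def using col assms(2)
    by (intro exI[of _ "col \<circ> f"]) (auto simp: image_subset_iff)
qed

lemma dist_le_ediameter:
  assumes "ediameter d C \<le> ereal D" "u \<in> C" "v \<in> C"
  shows "d u v \<le> D"
proof -
  have "ereal (d u v) \<le> ediameter d C"
    unfolding ediameter_def using assms(2,3) by (meson SUP_upper SUP_upper2)
  then show ?thesis
    using assms(1) by (meson ereal_less_eq(3) order_trans)
qed

text \<open>Paths of close points concatenate, and by symmetry they reverse, so the components of
  the \<open>lam\<close>-graph on \<open>X\<close> are clusters. In the application \<open>X\<close>
  is one colour class.\<close>

lemma cluster_at_scale_rtrancl: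
  fixes d :: "'a \<Rightarrow> 'a \<Rightarrow> real" and lam :: real and X :: "'a set"
  defines "E \<equiv> {(u, v). u \<in> X \<and> v \<in> X \<and> d u v \<le> lam}"
  assumes sym: "\<And>u v. u \<in> X \<Longrightarrow> v \<in> X \<Longrightarrow> d u v = d v u"
  shows "cluster_at_scale d lam (E\<^sup>* `` {x})"
  unfolding cluster_at_scale_def
proof (intro ballI)
  fix u v assume u: "u \<in> E\<^sup>* `` {x}" and v: "v \<in> E\<^sup>* `` {x}"
  have "sym (E\<^sup>*)"
    using sym by (intro sym_rtrancl) (auto simp: sym_def E_def)
  then have ux: "(u, x) \<in> E\<^sup>*"
    using u by (auto dest: symD)
  have "(u, v) \<in> E\<^sup>*"
    using ux v by (auto intro: rtrancl_trans)
  then show "connected_at_scale d lam (E\<^sup>* `` {x}) u v"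
  proof (induction rule: rtrancl_induct)
    case base
    then show ?case
      unfolding connected_at_scale_def using u by (intro exI[of _ "[u]"]) auto
  next
    case (step y z)
    then obtain p where "p \<noteq> []" "hd p = u" "last p = y" "set p \<subseteq> E\<^sup>* `` {x}"
      "successively (\<lambda>u v. d u v \<le> lam) p"
      unfolding connected_at_scale_def by blast
    moreover have "z \<in> E\<^sup>* `` {x}"
      using u step by (auto intro: rtrancl_trans)
    moreover have "d y z \<le> lam"
      using step by (auto simp: E_def)
    ultimately show ?case
      unfolding connected_at_scale_def
      by (intro exI[of _ "p @ [z]"]) (auto simp: successively_append_iff)
  qed
qed

section \<open>Upper bound by greedy colouring\<close>

text \<open>Along a well-order of the vertices, each vertex takes a colour that no earlier neighbour
  has; of the \<open>N + 1\<close> colours at most \<open>N\<close> are excluded.\<close>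

lemma greedy_coloring:
  fixes R :: "'a \<Rightarrow> 'a \<Rightarrow> bool"
  assumes deg: "\<And>x. finite {y. R x y} \<and> card {y. R x y} \<le> N"
    and sym: "\<And>x y. R x y \<Longrightarrow> R y x"
  shows "\<exists>col :: 'a \<Rightarrow> nat. (\<forall>x. col x \<le> N) \<and> (\<forall>x y. R x y \<and> x \<noteq> y \<longrightarrow> col x \<noteq> col y)"
proof -
  obtain r :: "'a rel" where r: "Well_order r" "Field r = UNIV"
    by (metis well_ordering)
  let ?P = "\<lambda>f x (c::nat). c \<le> N \<and> (\<forall>y. (y, x) \<in> r - Id \<and> R x y \<longrightarrow> f y \<noteq> c)"
  have wf: "wf (r - Id)"
    using r(1) by (simp add: well_order_on_def)
  have "\<exists>f. \<forall>x. ?P f x (f x)"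
  \<comment> \<open>The condition on the colour of \<open>x\<close> involves \<open>f\<close> only
    at predecessors of \<open>x\<close>, as recursion along \<open>r - Id\<close> requires.\<close>
  proof (rule dependent_wf_choice[OF wf])
    fix f :: "'a \<Rightarrow> nat" and x
    have "card (f ` {y. R x y}) < card {..N}"
      using deg[of x] card_image_le[of "{y. R x y}" f] by simp
    then obtain c where "c \<in> {..N}" "c \<notin> f ` {y. R x y}"
      using deg[of x] by (metis card_mono finite_imageI not_le subsetI)
    then show "\<exists>c. ?P f x c" by (intro exI[of _ c]) auto
  qed auto
  then obtain f where f: "\<forall>x. ?P f x (f x)" by (elim exE)
  have "f x \<noteq> f y" if xy: "R x y" "x \<noteq> y" for x y
  proof -
    have "(x, y) \<in> r - Id \<or> (y, x) \<in> r - Id"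
      using r xy(2) by (auto simp: well_order_on_def linear_order_on_def total_on_def)
    then show ?thesis using f[rule_format, of x] f[rule_format, of y] xy(1) sym[of x y] by auto
  qed
  moreover have "f x \<le> N" for x using f by simp
  ultimately show ?thesis by (intro exI[of _ f] conjI allI impI) simp_all
qed

lemma controlled_dim_le_ball_card:
  assumes M: "Metric_space X d" and D: "0 \<le> D" 
    and ball: "\<And>x. x \<in> X \<Longrightarrow> finite {y \<in> X. d x y \<le> lam} \<and> card {y \<in> X. d x y \<le> lam} \<le> N"
  shows "controlled_dim_le X d lam D N"
proof -
  interpret Metric_space X d by fact
  let ?R = "\<lambda>x y. x \<in> X \<and> y \<in> X \<and> d x y \<le> lam"
  have "\<exists>col :: 'a \<Rightarrow> nat. (\<forall>x. col x \<le> N) \<and> (\<forall>x y. ?R x y \<and> x \<noteq> y \<longrightarrow> col x \<noteq> col y)"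
  proof (rule greedy_coloring)
    show "finite {y. ?R x y} \<and> card {y. ?R x y} \<le> N" for x
      using ball[of x] by (cases "x \<in> X") auto
  qed (auto simp: commute)
  then obtain col :: "'a \<Rightarrow> nat" where
    col: "\<forall>x. col x \<le> N" "\<forall>x y. ?R x y \<and> x \<noteq> y \<longrightarrow> col x \<noteq> col y" by (elim exE conjE)
  have "ediameter d C \<le> ereal D"
    if C: "C \<subseteq> X" "\<forall>x\<in>C. col x = k" "cluster_at_scale d lam C" for C k
  proof -
    \<comment> \<open>Consecutive points of such a path are close and of equal colour, hence equal;
      so a monochromatic cluster has at most one point.\<close>
    have path: "successively (\<lambda>u v. d u v \<le> lam) p \<Longrightarrow> set p \<subseteq> C \<Longrightarrow> p \<noteq> [] \<Longrightarrow> last p = hd p" for p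
    proof (induction p rule: induct_list012)
      case (3 x y zs)
      then have "x = y" using C col(2)[rule_format, of x y] by auto
      then show ?case using 3 by auto
    qed auto
    have "x = y" if "x \<in> C" "y \<in> C" for x y
      using C(3) that path unfolding cluster_at_scale_def connected_at_scale_def by metis
    then have "d x y \<le> D" if "x \<in> C" "y \<in> C" for x y
      using that D C(1) by (metis mdist_zero subsetD)
    then show ?thesis
      unfolding ediameter_def by (auto intro!: SUP_least)
  qed
  then show ?thesis
    unfolding controlled_dim_le_def using col(1)
    by (intro exI[of _ col]) (auto simp: less_Suc_eq_le)
qed

section \<open>Word length\<close>

context group
begin

lemma word_length_attained:
  assumes S: "S \<subseteq> carrier G" and gen: "generate G S = carrier G" and g: "g \<in> carrier G"
  obtains w where "length w = word_length G S g" "set w \<subseteq> S \<union> m_inv G ` S" "foldr (\<otimes>) w \<one> = g"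
proof -
  obtain w where "set w \<subseteq> S \<union> m_inv G ` S" "foldr (\<otimes>) w \<one> = g"
    using ex_word[OF _ S, of g] gen g by auto
  then have "\<exists>n w. length w = n \<and> set w \<subseteq> S \<union> m_inv G ` S \<and> foldr (\<otimes>) w \<one> = g" by blast
  from LeastI_ex[OF this] that show ?thesis unfolding word_length_def by blast
qed

lemma word_length_mult_le:
  assumes "S \<subseteq> carrier G" "generate G S = carrier G" and gh: "g \<in> carrier G" "h \<in> carrier G"
  shows "word_length G S (g \<otimes> h) \<le> word_length G S g + word_length G S h"
proof -
  interpret Metric_space "carrier G" "word_dist G S"
    using assms by (intro Metric_space_word_dist)
  show ?thesis
    using triangle[of \<one> g "g \<otimes> h"] gh by (simp add: word_dist_def m_assoc[symmetric])
qed

lemma word_length_inv: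
  assumes "S \<subseteq> carrier G" "generate G S = carrier G" and g: "g \<in> carrier G"
  shows "word_length G S (inv g) = word_length G S g"
proof -
  interpret Metric_space "carrier G" "word_dist G S"
    using assms by (intro Metric_space_word_dist)
  show ?thesis
    using commute[of \<one> g] g by (simp add: word_dist_def)
qed

lemma word_length_one: "word_length G S \<one> = 0"
  unfolding word_length_def by (intro Least_eq_0 exI[of _ "[]"]) auto

text \<open>Each point of the ball is \<open>x\<close> times a word of length at most the floor of
  \<open>lam\<close> in the generators and their inverses, so it suffices to count words.\<close>

lemma card_word_ball_le:
  fixes lam :: real
  assumes S: "S \<subseteq> carrier G" and gen: "generate G S = carrier G" and fin: "finite S"
    and x: "x \<in> carrier G"
  defines "B \<equiv> {y \<in> carrier G. word_dist G S x y \<le> lam}"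
  shows "finite B \<and> card B \<le> (card (S \<union> m_inv G ` S) + 1) ^ nat \<lfloor>lam\<rfloor>"
proof -
  let ?T = "S \<union> m_inv G ` S" and ?n = "nat \<lfloor>lam\<rfloor>"
  let ?W = "{w. set w \<subseteq> ?T \<and> length w \<le> ?n}"
  have T: "finite ?T" using fin by simp
  have sub: "B \<subseteq> (\<lambda>w. x \<otimes> foldr (\<otimes>) w \<one>) ` ?W"
  proof
    fix y assume "y \<in> B"
    then have y: "y \<in> carrier G" "real (word_length G S (inv x \<otimes> y)) \<le> lam"
      using x by (auto simp: B_def word_dist_def)
    obtain w where w: "length w = word_length G S (inv x \<otimes> y)" "set w \<subseteq> ?T"
      "foldr (\<otimes>) w \<one> = inv x \<otimes> y"
      using word_length_attained[OF S gen, of "inv x \<otimes> y"] x y(1) by auto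
    have "length w \<le> ?n" using y(2) w(1) by (simp add: le_nat_floor)
    moreover have "y = x \<otimes> foldr (\<otimes>) w \<one>"
      using x y(1) by (simp add: w(3) m_assoc[symmetric])
    ultimately show "y \<in> (\<lambda>w. x \<otimes> foldr (\<otimes>) w \<one>) ` ?W" using w(2) by blast
  qed
  have W: "finite ?W" using T by (rule finite_lists_length_le)
  \<comment> \<open>The words are counted by a geometric sum; this crude bound turns it into one
    power whose base does not depend on \<open>lam\<close>.\<close>
  have geo: "(\<Sum>i\<le>n. m ^ i) \<le> (m + 1) ^ n" for m n :: nat
  proof (induction n)
    case (Suc n)
    have "m * m ^ n \<le> m * (m + 1) ^ n" by (intro mult_left_mono power_mono) auto
    then have "(\<Sum>i\<le>n. m ^ i) + m * m ^ n \<le> (m + 1) ^ n + m * (m + 1) ^ n"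
      using Suc by (rule add_mono[rotated])
    then show ?case by simp
  qed simp
  have "card B \<le> card ?W"
    using sub W by (rule surj_card_le[rotated])
  also have "\<dots> \<le> (card ?T + 1) ^ ?n"
    using card_lists_length_le[OF T, of ?n] geo[of "card ?T" ?n] by simp
  finally show ?thesis using sub W finite_surj by blast
qed

lemma controlled_dim_le_word_dist:
  assumes S: "S \<subseteq> carrier G" "generate G S = carrier G" "finite S" and D: "0 \<le> D"
  shows "controlled_dim_le (carrier G) (word_dist G S) lam D ((card (S \<union> m_inv G ` S) + 1) ^ nat \<lfloor>lam\<rfloor>)"
  using S D by (intro controlled_dim_le_ball_card Metric_space_word_dist card_word_ball_le)

end

section \<open>Colourings of the cube\<close>

text \<open>
  Double counting of the pairs \<open>(J, i)\<close> with \<open>J \<in> F\<close> and \<open>i\<close> outside \<open>sym_diff J (rep J)\<close>: those with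
  \<open>sym_diff J {i} = Y\<close> have a common representative \<open>R\<close>, and \<open>i\<close> is one of the at most \<open>k + 1\<close> elements of
  \<open>sym_diff Y R\<close>.
\<close>

lemma card_family_le_by_neighbours:
  fixes I :: "'i set" and rep :: "'i set \<Rightarrow> 'i set"
  assumes I: "finite I" and F: "F \<subseteq> Pow I" and rep: "\<And>J. J \<in> F \<Longrightarrow> rep J \<subseteq> I"
    and near: "\<And>J. J \<in> F \<Longrightarrow> card (sym_diff J (rep J)) \<le> k"
    and common: "\<And>J K i j. J \<in> F \<Longrightarrow> K \<in> F \<Longrightarrow> i \<in> I \<Longrightarrow> j \<in> I \<Longrightarrow>
                   sym_diff J {i} = sym_diff K {j} \<Longrightarrow> rep J = rep K"
  shows "card F * (card I - k) \<le> (k + 1) * 2 ^ card I"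
proof -
  define E where "E = (SIGMA J:F. I - sym_diff J (rep J))"
  define g where "g = (\<lambda>(J, i :: 'i). sym_diff J {i})"
  have finF: "finite F" using F I by (simp add: finite_subset)
  have finE: "finite E" unfolding E_def using finF I by blast
  have "card F * (card I - k) \<le> (\<Sum>J\<in>F. card (I - sym_diff J (rep J)))"
  proof -
    have "card I - k \<le> card (I - sym_diff J (rep J))" if J: "J \<in> F" for J
    proof -
      have "sym_diff J (rep J) \<subseteq> I" using F rep J by blast
      then have "card (I - sym_diff J (rep J)) = card I - card (sym_diff J (rep J))"
        using I by (intro card_Diff_subset) (rule finite_subset)
      then show ?thesis
        using near[OF J] by simp
    qed
    then have "(\<Sum>J\<in>F. card I - k) \<le> (\<Sum>J\<in>F. card (I - sym_diff J (rep J)))"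
      by (rule sum_mono)
    then show ?thesis by simp
  qed
  also have "\<dots> = card E"
    unfolding E_def using finF I by (simp add: card_SigmaI)
  also have "\<dots> = (\<Sum>Y\<in>Pow I. card {e \<in> E. g e = Y})"
  proof -
    have "g ` E \<subseteq> Pow I"
      using F unfolding E_def g_def by fastforce
    then show ?thesis
      using sum.group[of E "Pow I" g "\<lambda>_. 1::nat"] finE I by simp
  qed
  also have "\<dots> \<le> (\<Sum>Y\<in>Pow I. k + 1)"
  proof (rule sum_mono)
    fix Y assume "Y \<in> Pow I"
    let ?A = "{e \<in> E. g e = Y}"
    show "card ?A \<le> k + 1"
    proof (cases "?A = {}")
      case False
      then obtain J0 i0 where J0: "(J0, i0) \<in> E" "sym_diff J0 {i0} = Y"
        by (auto simp: g_def)
      have mem: "J0 \<in> F" "i0 \<in> I" "i0 \<notin> sym_diff J0 (rep J0)"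
        using J0(1) by (auto simp: E_def)
      \<comment> \<open>Since \<open>i0\<close> lies outside the difference of \<open>J0\<close> and
        its representative, flipping it adds exactly one element; hence the bound
        \<open>k + 1\<close>.\<close>
      have Yr: "sym_diff Y (rep J0) = insert i0 (sym_diff J0 (rep J0))"
        using mem(3) J0(2) by auto
      have fin: "finite (sym_diff J0 (rep J0))"
      proof (rule finite_subset[OF _ I])
        show "sym_diff J0 (rep J0) \<subseteq> I" using F rep[OF mem(1)] mem(1) by blast
      qed
      \<comment> \<open>A pair over \<open>Y\<close> is determined by \<open>i\<close>, because
        flipping \<open>i\<close> in \<open>Y\<close> recovers \<open>J\<close>.\<close>
      have "?A \<subseteq> (\<lambda>i. (sym_diff Y {i}, i)) ` sym_diff Y (rep J0)"
      proof
        fix x assume "x \<in> ?A"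
        then obtain J i where x: "x = (J, i)" and Ji: "(J, i) \<in> E" "sym_diff J {i} = Y"
          by (cases x) (auto simp: g_def)
        have m: "J \<in> F" "i \<in> I" "i \<notin> sym_diff J (rep J)"
          using Ji(1) by (auto simp: E_def)
        have "rep J = rep J0"
          using common[OF m(1) mem(1) m(2) mem(2)] Ji(2) J0(2) by simp
        then have "i \<in> sym_diff Y (rep J0)" using m(3) Ji(2) by auto
        moreover have "J = sym_diff Y {i}" using Ji(2) by auto
        ultimately show "x \<in> (\<lambda>i. (sym_diff Y {i}, i)) ` sym_diff Y (rep J0)"
          using x by blast
      qed
      moreover have finY: "finite (sym_diff Y (rep J0))"
        unfolding Yr using fin by (rule finite.insertI)
      ultimately have "card ?A \<le> card (sym_diff Y (rep J0))"
        by (rule surj_card_le[rotated])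
      also have "\<dots> \<le> Suc (card (sym_diff J0 (rep J0)))"
        unfolding Yr by (simp only: card_insert_if[OF fin]) simp
      also have "\<dots> \<le> k + 1" using near[OF mem(1)] by simp
      finally show ?thesis .
    next
      case True
      then show ?thesis by (simp only: card.empty)
    qed
  qed
  also have "\<dots> = (k + 1) * 2 ^ card I"
    using I by (simp add: card_Pow)
  finally show ?thesis .
qed

text \<open>In one colour class every set is within Hamming distance \<open>k\<close> of a
  representative of its component, and sets with a common neighbour lie in the same component. The
  counting lemma bounds each class, and the \<open>n + 1\<close> classes exhaust the cube. The
  subtraction is truncated, so the claim is trivial once \<open>k\<close> reaches
  \<open>card I\<close>.\<close>

lemma controlled_dim_le_cube_lower_bound:
  fixes emb :: "'i set \<Rightarrow> 'a" and k :: nat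
  assumes I: "finite I" and emb: "emb ` Pow I \<subseteq> X"
    and sym: "\<And>x y. x \<in> X \<Longrightarrow> y \<in> X \<Longrightarrow> d x y = d y x"
    and close: "\<And>J K i j. J \<subseteq> I \<Longrightarrow> K \<subseteq> I \<Longrightarrow> i \<in> I \<Longrightarrow> j \<in> I \<Longrightarrow>
                  sym_diff J {i} = sym_diff K {j} \<Longrightarrow> d (emb J) (emb K) \<le> lam"
    and far: "\<And>J K. J \<subseteq> I \<Longrightarrow> K \<subseteq> I \<Longrightarrow> d (emb J) (emb K) \<le> D \<Longrightarrow> card (sym_diff J K) \<le> k"
    and dim: "controlled_dim_le X d lam D n"
  shows "card I - k \<le> (n + 1) * (k + 1)"
proof -
  define d' where "d' J K = d (emb J) (emb K)" for J K
  have "controlled_dim_le (Pow I) d' lam D n"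
    unfolding d'_def using dim emb by (rule controlled_dim_le_pullback)
  then obtain col :: "'i set \<Rightarrow> nat" where col: "col ` Pow I \<subseteq> {..<n + 1}"
    and diam: "\<forall>C c. C \<subseteq> Pow I \<and> (\<forall>x\<in>C. col x = c) \<and> cluster_at_scale d' lam C \<longrightarrow>
                 ediameter d' C \<le> ereal D"
    unfolding controlled_dim_le_def by (elim exE conjE)
  have sym': "d' J K = d' K J" if "J \<subseteq> I" "K \<subseteq> I" for J K
    unfolding d'_def using that emb by (intro sym) auto
  have colour_class: "card {J \<in> Pow I. col J = c} * (card I - k) \<le> (k + 1) * 2 ^ card I" for c
  proof -
    let ?F = "{J \<in> Pow I. col J = c}"
    define E where "E = {(u, v). u \<in> ?F \<and> v \<in> ?F \<and> d' u v \<le> lam}"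
    \<comment> \<open>The choice depends only on the component as a set, so all its members get the
      same representative.\<close>
    define rep where "rep J = (SOME K. K \<in> E\<^sup>* `` {J})" for J
    have cluster: "cluster_at_scale d' lam (E\<^sup>* `` {J})" for J
      unfolding E_def by (rule cluster_at_scale_rtrancl) (auto intro: sym')
    have sub: "E\<^sup>* `` {J} \<subseteq> ?F" if "J \<in> ?F" for J
    proof
      fix K assume "K \<in> E\<^sup>* `` {J}"
      then have "(J, K) \<in> E\<^sup>*" by simp
      then show "K \<in> ?F" by cases (use that in \<open>auto simp: E_def\<close>)
    qed
    have rep_mem: "rep J \<in> E\<^sup>* `` {J}" for J
      unfolding rep_def by (rule someI[of _ J]) simp
    show ?thesis
    proof (rule card_family_le_by_neighbours[OF I, where rep = rep])
      fix J assume J: "J \<in> ?F"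
      show "rep J \<subseteq> I" using rep_mem[of J] sub[OF J] by auto
      have "ediameter d' (E\<^sup>* `` {J}) \<le> ereal D"
        using sub[OF J] cluster by (intro diam[rule_format, of _ c]) auto
      then have "d' J (rep J) \<le> D"
        by (rule dist_le_ediameter) (use rep_mem in auto)
      then show "card (sym_diff J (rep J)) \<le> k"
        using far[of J "rep J"] J \<open>rep J \<subseteq> I\<close> by (auto simp: d'_def)
    next
      fix J K i j assume JK: "J \<in> ?F" "K \<in> ?F" "i \<in> I" "j \<in> I" "sym_diff J {i} = sym_diff K {j}"
      have "d' J K \<le> lam" unfolding d'_def using JK by (intro close) auto
      then have "(J, K) \<in> E\<^sup>*" "(K, J) \<in> E\<^sup>*"
        using JK sym'[of J K] by (auto simp: E_def)
      then have "E\<^sup>* `` {J} = E\<^sup>* `` {K}"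
        by (auto intro: rtrancl_trans)
      then show "rep J = rep K" by (simp add: rep_def)
    qed auto
  qed
  have "2 ^ card I = card (\<Union>c\<in>{..<n + 1}. {J \<in> Pow I. col J = c})"
  proof -
    have "(\<Union>c\<in>{..<n + 1}. {J \<in> Pow I. col J = c}) = Pow I" using col by auto
    then show ?thesis using I by (simp add: card_Pow)
  qed
  also have "\<dots> \<le> (\<Sum>c<n + 1. card {J \<in> Pow I. col J = c})"
    by (intro card_UN_le) simp
  finally have "2 ^ card I * (card I - k) \<le> (\<Sum>c<n + 1. card {J \<in> Pow I. col J = c} * (card I - k))"
    by (simp only: sum_distrib_right[symmetric] mult_le_mono1)
  also have "\<dots> \<le> (\<Sum>c<n + 1. (k + 1) * 2 ^ card I)"
    using colour_class by (rule sum_mono)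
  also have "\<dots> = 2 ^ card I * ((n + 1) * (k + 1))" by (simp add: algebra_simps)
  finally show ?thesis by (subst (asm) nat_mult_le_cancel_disj) simp
qed

section \<open>Wreath products and their derived series\<close>

lemma carrier_wreath_product:
  "carrier (wreath_product B A) = carrier (sum_group (carrier A) (\<lambda>_. B)) \<times> carrier A"
  by (simp add: wreath_product_def semidirect_product_def)

lemma mult_wreath_product:
  "(f, a) \<otimes>\<^bsub>wreath_product B A\<^esub> (g, b) =
     (\<lambda>x\<in>carrier A. f x \<otimes>\<^bsub>B\<^esub> translation A a g x, a \<otimes>\<^bsub>A\<^esub> b)"
  by (simp add: wreath_product_def semidirect_product_def)

lemma one_wreath_product: "\<one>\<^bsub>wreath_product B A\<^esub> = (\<lambda>x\<in>carrier A. \<one>\<^bsub>B\<^esub>, \<one>\<^bsub>A\<^esub>)"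
  by (simp add: wreath_product_def semidirect_product_def)

lemma group_hom_snd_wreath_product:
  assumes "group A" "group B"
  shows "group_hom (wreath_product B A) A snd"
  using assms group_wreath_product[OF assms]
  by (auto simp: group_hom_def group_hom_axioms_def hom_def carrier_wreath_product mult_wreath_product)

lemma snd_carrier_wreath_product:
  assumes "group A" "group B"
  shows "snd ` carrier (wreath_product B A) = carrier A"
proof -
  interpret N: group "sum_group (carrier A) (\<lambda>_. B)" using assms(2) by simp
  show ?thesis
    using N.one_closed by (force simp: carrier_wreath_product)
qed

lemma derived_eq_one_if_commuting:
  fixes G (structure)
  assumes "group G" "H \<subseteq> carrier G" and "H \<noteq> {}"
    and comm: "\<And>x y. x \<in> H \<Longrightarrow> y \<in> H \<Longrightarrow> x \<otimes> y = y \<otimes> x"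
  shows "derived G H = {\<one>}"
proof -
  interpret group G by fact
  have "x \<otimes> y \<otimes> inv x \<otimes> inv y = \<one>" if "x \<in> H" "y \<in> H" for x y
  proof -
    have xy: "x \<in> carrier G" "y \<in> carrier G" using that assms(2) by auto
    then have "x \<otimes> y \<otimes> inv x \<otimes> inv y = y \<otimes> x \<otimes> inv x \<otimes> inv y"
      using comm[OF that] by simp
    also have "\<dots> = \<one>" using xy by (simp add: m_assoc)
    finally show ?thesis .
  qed
  then have "derived_set G H = {\<one>}" using assms(3) by auto
  then show ?thesis by (simp add: derived_def generate_one)
qed

text \<open>The projection to \<open>A\<close> sends the \<open>n\<close>-th derived group to the
  identity, so that group lies in the base, which is abelian because \<open>B\<close> is; one more
  step makes it trivial.\<close>

lemma derived_funpow_wreath_product_abelian: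
  assumes A: "group A" and B: "comm_group B" and der: "(derived A ^^ n) (carrier A) = {\<one>\<^bsub>A\<^esub>}"
  shows "(derived (wreath_product B A) ^^ Suc n) (carrier (wreath_product B A)) =
           {\<one>\<^bsub>wreath_product B A\<^esub>}"
proof -
  interpret A: group A by fact
  interpret B: comm_group B by fact
  let ?W = "wreath_product B A"
  interpret W: group ?W using A B.group_axioms by (rule group_wreath_product)
  interpret snd: group_hom ?W A snd
    using A B.group_axioms by (rule group_hom_snd_wreath_product)
  let ?H = "(derived ?W ^^ n) (carrier ?W)"
  have sub: "?H \<subseteq> carrier ?W" by (rule W.exp_of_derived_in_carrier) simp
  have img: "snd ` ?H = {\<one>\<^bsub>A\<^esub>}"
    using snd.exp_of_derived_img[of "carrier ?W" n] der
    by (simp add: snd_carrier_wreath_product[OF A B.group_axioms])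
  have comm: "x \<otimes>\<^bsub>?W\<^esub> y = y \<otimes>\<^bsub>?W\<^esub> x" if "x \<in> ?H" "y \<in> ?H" for x y
  proof -
    have "snd x = \<one>\<^bsub>A\<^esub>" "snd y = \<one>\<^bsub>A\<^esub>" "x \<in> carrier ?W" "y \<in> carrier ?W"
      using that img sub by auto
    then obtain f g where "x = (f, \<one>\<^bsub>A\<^esub>)" "y = (g, \<one>\<^bsub>A\<^esub>)"
      "\<And>z. z \<in> carrier A \<Longrightarrow> f z \<in> carrier B" "\<And>z. z \<in> carrier A \<Longrightarrow> g z \<in> carrier B"
      by (cases x; cases y) (auto simp: carrier_wreath_product carrier_sum_group B.group_axioms)
    then show ?thesis
      by (auto simp: mult_wreath_product translation_def B.m_comm intro!: restrict_ext)
  qed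
  show ?thesis
    using derived_eq_one_if_commuting[OF W.group_axioms sub _ comm] img by auto
qed

section \<open>Lamp elements and shifts in an integer wreath product\<close>

text \<open>For \<open>J\<close> ranging over the subsets of a finite set of positions, these are
  the vertices of the cube used in the lower bound.\<close>

definition lamps :: "('a, 'x) monoid_scheme \<Rightarrow> 'a set \<Rightarrow> ('a \<Rightarrow> int) \<times> 'a" where
  "lamps A J = (\<lambda>x\<in>carrier A. if x \<in> J then 1 else 0, \<one>\<^bsub>A\<^esub>)"

definition shift :: "('a, 'x) monoid_scheme \<Rightarrow> 'a \<Rightarrow> ('a \<Rightarrow> int) \<times> 'a" where
  "shift A a = (\<lambda>x\<in>carrier A. 0, a)"

lemma carrier_integer_wreath_product:
  "(f, a) \<in> carrier (wreath_product integer_group A) \<longleftrightarrow>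
     f \<in> extensional (carrier A) \<and> finite {x \<in> carrier A. f x \<noteq> 0} \<and> a \<in> carrier A"
  by (auto simp: carrier_wreath_product carrier_sum_group PiE_iff)

lemma inv_integer_wreath_product:
  assumes A: "group A" and fa: "(f, a) \<in> carrier (wreath_product integer_group A)"
  shows "inv\<^bsub>wreath_product integer_group A\<^esub> (f, a) =
           (\<lambda>x\<in>carrier A. - f (a \<otimes>\<^bsub>A\<^esub> x), inv\<^bsub>A\<^esub> a)"
proof -
  interpret A: group A by fact
  interpret W: group "wreath_product integer_group A" using A by (simp add: group_wreath_product)
  have a: "a \<in> carrier A" using fa by (simp add: carrier_integer_wreath_product)
  have "{x \<in> carrier A. f (a \<otimes>\<^bsub>A\<^esub> x) \<noteq> 0}
      \<subseteq> (\<lambda>x. inv\<^bsub>A\<^esub> a \<otimes>\<^bsub>A\<^esub> x) ` {x \<in> carrier A. f x \<noteq> 0}"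
  proof
    fix x assume x: "x \<in> {x \<in> carrier A. f (a \<otimes>\<^bsub>A\<^esub> x) \<noteq> 0}"
    then have "x = inv\<^bsub>A\<^esub> a \<otimes>\<^bsub>A\<^esub> (a \<otimes>\<^bsub>A\<^esub> x)" using a by (simp add: A.m_assoc[symmetric])
    then show "x \<in> (\<lambda>x. inv\<^bsub>A\<^esub> a \<otimes>\<^bsub>A\<^esub> x) ` {x \<in> carrier A. f x \<noteq> 0}" using x a by blast
  qed
  then have "finite {x \<in> carrier A. f (a \<otimes>\<^bsub>A\<^esub> x) \<noteq> 0}"
    using fa finite_surj by (auto simp: carrier_integer_wreath_product)
  then have "(\<lambda>x\<in>carrier A. - f (a \<otimes>\<^bsub>A\<^esub> x), inv\<^bsub>A\<^esub> a) \<in> carrier (wreath_product integer_group A)"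
    using a by (simp add: carrier_integer_wreath_product cong: conj_cong)
  moreover have "(\<lambda>x\<in>carrier A. - f (a \<otimes>\<^bsub>A\<^esub> x), inv\<^bsub>A\<^esub> a) \<otimes>\<^bsub>wreath_product integer_group A\<^esub> (f, a)
      = \<one>\<^bsub>wreath_product integer_group A\<^esub>"
    using a by (auto simp: mult_wreath_product one_wreath_product translation_def)
  ultimately show ?thesis
    using fa by (intro W.inv_equality) auto
qed

lemma lamps_in_carrier:
  assumes "group A" "finite J"
  shows "lamps A J \<in> carrier (wreath_product integer_group A)"
proof -
  have "finite {x \<in> carrier A. (if x \<in> J then 1 else 0) \<noteq> (0::int)}"
    using assms(2) by (rule finite_subset[rotated]) auto
  then show ?thesis
    using assms(1) by (simp add: lamps_def carrier_integer_wreath_product group.is_monoid monoid.one_closed cong: conj_cong)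
qed

lemma shift_in_carrier:
  assumes "a \<in> carrier A"
  shows "shift A a \<in> carrier (wreath_product integer_group A)"
  using assms by (simp add: shift_def carrier_integer_wreath_product cong: conj_cong)

lemma shift_mult:
  assumes "group A" "a \<in> carrier A"
  shows "shift A a \<otimes>\<^bsub>wreath_product integer_group A\<^esub> shift A b = shift A (a \<otimes>\<^bsub>A\<^esub> b)"
proof -
  interpret group A by fact
  show ?thesis
    using assms(2) by (auto simp: shift_def mult_wreath_product translation_def)
qed

lemma shift_one: "shift A \<one>\<^bsub>A\<^esub> = \<one>\<^bsub>wreath_product integer_group A\<^esub>"
  by (simp add: shift_def one_wreath_product)

lemma inv_shift:
  assumes "group A" "a \<in> carrier A"
  shows "inv\<^bsub>wreath_product integer_group A\<^esub> (shift A a) = shift A (inv\<^bsub>A\<^esub> a)"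
proof -
  interpret group A by fact
  show ?thesis
    using inv_integer_wreath_product[OF assms(1)] shift_in_carrier[OF assms(2)] assms(2)
    by (auto simp: shift_def)
qed

lemma inv_lamps:
  assumes "group A" "finite J"
  shows "inv\<^bsub>wreath_product integer_group A\<^esub> (lamps A J) =
           (\<lambda>x\<in>carrier A. if x \<in> J then -1 else 0, \<one>\<^bsub>A\<^esub>)"
proof -
  interpret group A by fact
  show ?thesis
    using inv_integer_wreath_product[OF assms(1)] lamps_in_carrier[OF assms]
    by (auto simp: lamps_def intro!: restrict_ext)
qed

lemma shift_lamps:
  assumes "group A" "a \<in> carrier A"
  shows "shift A a \<otimes>\<^bsub>wreath_product integer_group A\<^esub> lamps A J =
           (\<lambda>x\<in>carrier A. if inv\<^bsub>A\<^esub> a \<otimes>\<^bsub>A\<^esub> x \<in> J then 1 else 0, a)"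
proof -
  interpret group A by fact
  show ?thesis
    using assms(2) by (auto simp: shift_def lamps_def mult_wreath_product translation_def intro!: restrict_ext)
qed

text \<open>Conjugation by a shift carries the lamp at the identity to \<open>a\<close>, so a lamp
  at \<open>a\<close> costs at most twice the length of the shift plus one fixed lamp.\<close>

lemma conj_shift_lamps_one:
  assumes "group A" "a \<in> carrier A"
  shows "shift A a \<otimes>\<^bsub>wreath_product integer_group A\<^esub> lamps A {\<one>\<^bsub>A\<^esub>}
           \<otimes>\<^bsub>wreath_product integer_group A\<^esub> inv\<^bsub>wreath_product integer_group A\<^esub> (shift A a) = lamps A {a}"
proof -
  interpret group A by fact
  have eq: "inv\<^bsub>A\<^esub> a \<otimes>\<^bsub>A\<^esub> x = \<one>\<^bsub>A\<^esub> \<longleftrightarrow> x = a" if "x \<in> carrier A" for x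
    using that assms(2) by (metis inv_closed inv_equality inv_inv l_inv)
  show ?thesis
    unfolding shift_lamps[OF assms] inv_shift[OF assms] using assms(2) eq
    by (auto simp: shift_def lamps_def mult_wreath_product translation_def intro!: restrict_ext)
qed

lemma inv_lamps_mult_lamps:
  assumes "group A" "finite J"
  shows "inv\<^bsub>wreath_product integer_group A\<^esub> (lamps A J) \<otimes>\<^bsub>wreath_product integer_group A\<^esub> lamps A K =
           (\<lambda>x\<in>carrier A. (if x \<in> K then 1 else 0) - (if x \<in> J then 1 else 0), \<one>\<^bsub>A\<^esub>)"
proof -
  interpret group A by fact
  show ?thesis
    unfolding inv_lamps[OF assms]
    by (auto simp: lamps_def mult_wreath_product translation_def intro!: restrict_ext)
qed

section \<open>Nontrivial derived groups\<close>

text \<open>The commutator of \<open>shift A t\<close> with the lamp at the identity has value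
  \<open>1\<close> at \<open>t\<close> and \<open>-1\<close> at the identity. Only the position of
  the unique negative value is recorded, since every nontrivial translation moves it.\<close>

lemma commutator_shift_lamps:
  assumes "group A" "t \<in> carrier A" "t \<noteq> \<one>\<^bsub>A\<^esub>"
  obtains v where "(v, \<one>\<^bsub>A\<^esub>) \<in> derived (wreath_product integer_group A) (carrier (wreath_product integer_group A))"
    "v \<one>\<^bsub>A\<^esub> = -1" "\<And>x. x \<in> carrier A \<Longrightarrow> x \<noteq> \<one>\<^bsub>A\<^esub> \<Longrightarrow> 0 \<le> v x"
proof -
  interpret group A by fact
  let ?W = "wreath_product integer_group A"
  let ?v = "\<lambda>x\<in>carrier A. (if x = t then 1 else 0) + (if x = \<one>\<^bsub>A\<^esub> then -1 else 0) :: int"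
  have "shift A t \<otimes>\<^bsub>?W\<^esub> lamps A {\<one>\<^bsub>A\<^esub>} \<otimes>\<^bsub>?W\<^esub> inv\<^bsub>?W\<^esub> (shift A t) \<otimes>\<^bsub>?W\<^esub> inv\<^bsub>?W\<^esub> (lamps A {\<one>\<^bsub>A\<^esub>})
      = lamps A {t} \<otimes>\<^bsub>?W\<^esub> inv\<^bsub>?W\<^esub> (lamps A {\<one>\<^bsub>A\<^esub>})"
    by (simp add: conj_shift_lamps_one[OF assms(1,2)])
  also have "\<dots> = (?v, \<one>\<^bsub>A\<^esub>)"
    using inv_lamps[OF assms(1), of "{\<one>\<^bsub>A\<^esub>}"]
    by (auto simp: lamps_def mult_wreath_product translation_def intro!: restrict_ext)
  finally have "(?v, \<one>\<^bsub>A\<^esub>) \<in> derived_set ?W (carrier ?W)"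
    using shift_in_carrier[OF assms(2)] lamps_in_carrier[OF assms(1), of "{\<one>\<^bsub>A\<^esub>}"] by force
  then have "(?v, \<one>\<^bsub>A\<^esub>) \<in> derived ?W (carrier ?W)"
    unfolding derived_def by (rule generate.incl)
  then show ?thesis by (rule that) (use assms(2,3) in auto)
qed

lemma derived_integer_wreath_product_nontrivial:
  assumes "group A" "t \<in> carrier A" "t \<noteq> \<one>\<^bsub>A\<^esub>"
  shows "\<exists>x \<in> derived (wreath_product integer_group A) (carrier (wreath_product integer_group A)).
           x \<noteq> \<one>\<^bsub>wreath_product integer_group A\<^esub>"
proof -
  interpret group A by fact
  show ?thesis
    by (rule commutator_shift_lamps[OF assms]) (auto simp: one_wreath_product fun_eq_iff split: if_splits dest!: spec[of _ "\<one>\<^bsub>A\<^esub>"] intro!: bexI[rotated])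
qed

lemma derived_derived_integer_wreath_product_nontrivial:
  assumes "group A" "c \<in> derived A (carrier A)" "c \<noteq> \<one>\<^bsub>A\<^esub>"
  defines "W \<equiv> wreath_product integer_group A"
  shows "\<exists>x \<in> derived W (derived W (carrier W)). x \<noteq> \<one>\<^bsub>W\<^esub>"
proof -
  interpret A: group A by fact
  interpret W: group W unfolding W_def using assms(1) by (simp add: group_wreath_product)
  interpret snd: group_hom W A snd
    unfolding W_def using assms(1) by (simp add: group_hom_snd_wreath_product)
  have c: "c \<in> carrier A" using assms(2) A.derived_in_carrier by blast
  obtain v where v: "(v, \<one>\<^bsub>A\<^esub>) \<in> derived W (carrier W)"
    "v \<one>\<^bsub>A\<^esub> = -1" "\<And>x. x \<in> carrier A \<Longrightarrow> x \<noteq> \<one>\<^bsub>A\<^esub> \<Longrightarrow> 0 \<le> v x"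
    unfolding W_def using commutator_shift_lamps[OF assms(1) c assms(3)] by blast
  \<comment> \<open>The projection onto \<open>A\<close> maps the derived group onto the derived
    group, so \<open>c\<close> lifts to an element of the derived group of \<open>W\<close>.\<close>
  have "snd ` derived W (carrier W) = derived A (carrier A)"
    using snd.derived_img[of "carrier W"] snd_carrier_wreath_product[OF assms(1), of integer_group]
    by (simp add: W_def)
  then obtain f where f: "(f, c) \<in> derived W (carrier W)"
    using assms(2) by (metis image_iff prod.collapse)
  let ?x = "(f, c)" and ?y = "(v, \<one>\<^bsub>A\<^esub>)"
  have car: "?x \<in> carrier W" "?y \<in> carrier W" using f v(1) W.derived_in_carrier by blast+
  \<comment> \<open>\<open>(f, c)\<close> and \<open>(v, 1)\<close> both lie in the derived group; they do not commute, since translation by \<open>c\<close>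
    moves the only negative value of \<open>v\<close>.\<close>
  have "v (inv\<^bsub>A\<^esub> c) \<noteq> v \<one>\<^bsub>A\<^esub>"
    using v(2) v(3)[of "inv\<^bsub>A\<^esub> c"] c assms(3) A.inv_eq_1_iff by force
  moreover have "fst (?x \<otimes>\<^bsub>W\<^esub> ?y) \<one>\<^bsub>A\<^esub> = f \<one>\<^bsub>A\<^esub> + v (inv\<^bsub>A\<^esub> c)"
    "fst (?y \<otimes>\<^bsub>W\<^esub> ?x) \<one>\<^bsub>A\<^esub> = v \<one>\<^bsub>A\<^esub> + f \<one>\<^bsub>A\<^esub>"
    using c by (simp_all add: W_def mult_wreath_product translation_def)
  ultimately have ne: "?x \<otimes>\<^bsub>W\<^esub> ?y \<noteq> ?y \<otimes>\<^bsub>W\<^esub> ?x" by auto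
  let ?z = "?x \<otimes>\<^bsub>W\<^esub> ?y \<otimes>\<^bsub>W\<^esub> inv\<^bsub>W\<^esub> ?x \<otimes>\<^bsub>W\<^esub> inv\<^bsub>W\<^esub> ?y"
  have "?z \<in> derived W (derived W (carrier W))"
    unfolding derived_def[of W "derived W (carrier W)"] using f v(1) by (intro generate.incl) blast
  moreover have "?z \<noteq> \<one>\<^bsub>W\<^esub>"
  proof -
    have "inv\<^bsub>W\<^esub> ?y \<otimes>\<^bsub>W\<^esub> (?y \<otimes>\<^bsub>W\<^esub> ?x) = ?x"
      using car by (simp add: W.m_assoc[symmetric])
    then have "?z \<otimes>\<^bsub>W\<^esub> (?y \<otimes>\<^bsub>W\<^esub> ?x) = ?x \<otimes>\<^bsub>W\<^esub> ?y"
      using car by (simp add: W.m_assoc)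
    then show ?thesis using ne car by auto
  qed
  ultimately show ?thesis by blast
qed

lemma (in group) funpow_derived_eq_one_mono:
  assumes "(derived G ^^ m) H = {\<one>}" "m \<le> n"
  shows "(derived G ^^ n) H = {\<one>}"
  using assms(2)
proof (induction n rule: dec_induct)
  case (step n)
  have "derived G {\<one>} = {\<one>}"
    by (rule derived_eq_one_if_commuting[OF group_axioms]) simp_all
  then show ?case using step.IH by simp
qed (rule assms(1))

lemma group_integer_wreath_integer: "group (wreath_product integer_group integer_group)"
  by (simp add: group_wreath_product)

text \<open>At most 3: each of the two wreath layers adds one step to the abelian group of integers.
  At least 3: a nontrivial element in the derived group of \<open>?H\<close> forces a nontrivial
  second derived group one layer up, while triviality at any \<open>m < 3\<close> would persist to
  step 2.\<close>

lemma has_derived_length_Z_wr_Z_wr_Z: "has_derived_length Z_wr_Z_wr_Z 3"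
proof -
  let ?H = "wreath_product integer_group integer_group"
  interpret H: group ?H by (rule group_integer_wreath_integer)
  interpret G: group Z_wr_Z_wr_Z by (simp add: group_wreath_product)
  have "(derived integer_group ^^ 1) (carrier integer_group) = {\<one>\<^bsub>integer_group\<^esub>}"
    using comm_group.derived_eq_singleton[OF abelian_integer_group] by simp
  then have "(derived Z_wr_Z_wr_Z ^^ 3) (carrier Z_wr_Z_wr_Z) = {\<one>\<^bsub>Z_wr_Z_wr_Z\<^esub>}"
    unfolding numeral_3_eq_3 One_nat_def
    by (intro derived_funpow_wreath_product_abelian H.group_axioms group_integer_group
        abelian_integer_group)
  moreover have "(derived Z_wr_Z_wr_Z ^^ m) (carrier Z_wr_Z_wr_Z) \<noteq> {\<one>\<^bsub>Z_wr_Z_wr_Z\<^esub>}" if "m < 3" for m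
  proof
    assume triv: "(derived Z_wr_Z_wr_Z ^^ m) (carrier Z_wr_Z_wr_Z) = {\<one>\<^bsub>Z_wr_Z_wr_Z\<^esub>}"
    obtain c where c: "c \<in> derived ?H (carrier ?H)" "c \<noteq> \<one>\<^bsub>?H\<^esub>"
      using derived_integer_wreath_product_nontrivial[of integer_group 1] by auto
    then obtain x where x: "x \<in> (derived Z_wr_Z_wr_Z ^^ 2) (carrier Z_wr_Z_wr_Z)" "x \<noteq> \<one>\<^bsub>Z_wr_Z_wr_Z\<^esub>"
      using derived_derived_integer_wreath_product_nontrivial[OF H.group_axioms c]
      by (auto simp: numeral_2_eq_2)
    have "(derived Z_wr_Z_wr_Z ^^ 2) (carrier Z_wr_Z_wr_Z) = {\<one>\<^bsub>Z_wr_Z_wr_Z\<^esub>}"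
      using that by (intro G.funpow_derived_eq_one_mono[OF triv]) simp
    then show False using x by simp
  qed
  ultimately show ?thesis unfolding has_derived_length_def by blast
qed

section \<open>Lamp supports and word length\<close>

definition lamp_support :: "('a, 'x) monoid_scheme \<Rightarrow> ('a \<Rightarrow> int) \<times> 'a \<Rightarrow> 'a set" where
  "lamp_support A g = {x \<in> carrier A. fst g x \<noteq> 0}"

lemma finite_lamp_support:
  "g \<in> carrier (wreath_product integer_group A) \<Longrightarrow> finite (lamp_support A g)"
  by (cases g) (simp add: lamp_support_def carrier_integer_wreath_product)

text \<open>Right multiplication by \<open>h\<close> adds at most a translate of the support of
  \<open>h\<close>.\<close>

lemma card_lamp_support_mult_le:
  assumes A: "group A" and g: "g \<in> carrier (wreath_product integer_group A)"
    and h: "h \<in> carrier (wreath_product integer_group A)"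
  shows "card (lamp_support A (g \<otimes>\<^bsub>wreath_product integer_group A\<^esub> h)) \<le>
           card (lamp_support A g) + card (lamp_support A h)"
proof -
  interpret group A by fact
  obtain f a where fa: "g = (f, a)" "a \<in> carrier A"
    using g by (cases g) (auto simp: carrier_integer_wreath_product)
  obtain f' b where fb: "h = (f', b)" by (cases h)
  let ?s = "\<lambda>x. a \<otimes>\<^bsub>A\<^esub> x"
  have "lamp_support A (g \<otimes>\<^bsub>wreath_product integer_group A\<^esub> h)
      \<subseteq> lamp_support A g \<union> ?s ` lamp_support A h"
  proof
    fix x assume "x \<in> lamp_support A (g \<otimes>\<^bsub>wreath_product integer_group A\<^esub> h)"
    then have x: "x \<in> carrier A" "f x \<noteq> 0 \<or> f' (inv\<^bsub>A\<^esub> a \<otimes>\<^bsub>A\<^esub> x) \<noteq> 0"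
      by (auto simp: lamp_support_def fa(1) fb mult_wreath_product translation_def)
    moreover have "x = ?s (inv\<^bsub>A\<^esub> a \<otimes>\<^bsub>A\<^esub> x)" using x(1) fa(2) by (simp add: m_assoc[symmetric])
    moreover have "inv\<^bsub>A\<^esub> a \<otimes>\<^bsub>A\<^esub> x \<in> carrier A" using x(1) fa(2) by simp
    ultimately show "x \<in> lamp_support A g \<union> ?s ` lamp_support A h"
      unfolding lamp_support_def fa(1) fb by auto
  qed
  then have "card (lamp_support A (g \<otimes>\<^bsub>wreath_product integer_group A\<^esub> h))
      \<le> card (lamp_support A g \<union> ?s ` lamp_support A h)"
    using finite_lamp_support[OF g] finite_lamp_support[OF h] by (intro card_mono finite_UnI finite_imageI)
  also have "\<dots> \<le> card (lamp_support A g) + card (lamp_support A h)"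
    using card_Un_le[of "lamp_support A g" "?s ` lamp_support A h"]
      card_image_le[OF finite_lamp_support[OF h], of ?s] by linarith
  finally show ?thesis .
qed

text \<open>By subadditivity each letter of a word adds a bounded number of lit positions. On the
  cube this makes word distance dominate Hamming distance up to the factor \<open>M\<close>.\<close>

lemma card_lamp_support_le_word_length:
  assumes A: "group A" and S: "S \<subseteq> carrier (wreath_product integer_group A)"
    "generate (wreath_product integer_group A) S = carrier (wreath_product integer_group A)" "finite S"
  obtains M :: nat where "\<And>g. g \<in> carrier (wreath_product integer_group A) \<Longrightarrow>
       card (lamp_support A g) \<le> M * word_length (wreath_product integer_group A) S g"
proof -
  let ?W = "wreath_product integer_group A"
  let ?T = "S \<union> m_inv ?W ` S"
  interpret W: group ?W using A by (simp add: group_wreath_product)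
  have T: "?T \<subseteq> carrier ?W" "finite ?T" using S by auto
  define M where "M = (\<Sum>s\<in>?T. card (lamp_support A s))"
  have M: "card (lamp_support A s) \<le> M" if "s \<in> ?T" for s
    unfolding M_def using member_le_sum[OF that _ T(2), of "\<lambda>s. card (lamp_support A s)"] by simp
  have word: "card (lamp_support A (foldr (\<otimes>\<^bsub>?W\<^esub>) w \<one>\<^bsub>?W\<^esub>)) \<le> M * length w" if "set w \<subseteq> ?T" for w
    using that
  proof (induction w)
    case Nil
    then show ?case by (simp add: lamp_support_def one_wreath_product cong: conj_cong)
  next
    case (Cons s w)
    have "card (lamp_support A (s \<otimes>\<^bsub>?W\<^esub> foldr (\<otimes>\<^bsub>?W\<^esub>) w \<one>\<^bsub>?W\<^esub>)) \<le>
        card (lamp_support A s) + card (lamp_support A (foldr (\<otimes>\<^bsub>?W\<^esub>) w \<one>\<^bsub>?W\<^esub>))"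
      using Cons.prems T(1) by (intro card_lamp_support_mult_le[OF A] W.foldr_mult_closed) auto
    also have "\<dots> \<le> M + M * length w"
      using Cons M[of s] by (intro add_mono) auto
    finally show ?case by simp
  qed
  show ?thesis
  proof (rule that[of M])
    fix g assume "g \<in> carrier ?W"
    then obtain w where "length w = word_length ?W S g" "set w \<subseteq> ?T"
      "foldr (\<otimes>\<^bsub>?W\<^esub>) w \<one>\<^bsub>?W\<^esub> = g"
      by (rule W.word_length_attained[OF S(1,2)])
    then show "card (lamp_support A g) \<le> M * word_length ?W S g"
      using word[of w] by simp
  qed
qed

section \<open>The cube inside an integer wreath product\<close>

lemma lamp_support_inv_lamps_mult_lamps:
  assumes "group A" "finite J" "J \<subseteq> carrier A" "K \<subseteq> carrier A"
  shows "lamp_support A (inv\<^bsub>wreath_product integer_group A\<^esub> (lamps A J)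
           \<otimes>\<^bsub>wreath_product integer_group A\<^esub> lamps A K) = sym_diff J K"
  using assms(3,4) by (auto simp: lamp_support_def inv_lamps_mult_lamps[OF assms(1,2)] split: if_splits)

text \<open>Both elements have cursor at the identity, so the flip is right multiplication by the
  lamp at \<open>i\<close> or by its inverse, according to whether \<open>i\<close> lies in
  \<open>J\<close>; the two have equal length.\<close>

lemma word_dist_lamps_sym_diff_singleton:
  fixes S
  assumes A: "group A" and J: "finite J" and i: "i \<in> carrier A"
    and S: "S \<subseteq> carrier (wreath_product integer_group A)"
    "generate (wreath_product integer_group A) S = carrier (wreath_product integer_group A)"
  shows "word_dist (wreath_product integer_group A) S (lamps A J) (lamps A (sym_diff J {i})) =
           word_length (wreath_product integer_group A) S (lamps A {i})"
proof -
  let ?W = "wreath_product integer_group A"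
  interpret group A by fact
  interpret W: group ?W using A by (simp add: group_wreath_product)
  have car: "lamps A K \<in> carrier ?W" if "finite K" for K using A that by (rule lamps_in_carrier)
  have "inv\<^bsub>?W\<^esub> (lamps A J) \<otimes>\<^bsub>?W\<^esub> lamps A (sym_diff J {i}) =
      (if i \<in> J then inv\<^bsub>?W\<^esub> (lamps A {i}) else lamps A {i})"
    unfolding inv_lamps_mult_lamps[OF A J] inv_lamps[OF A finite.insertI[OF finite.emptyI]]
    by (auto simp: lamps_def fun_eq_iff)
  then show ?thesis
    using W.word_length_inv[OF S car[of "{i}"]] J by (simp add: word_dist_def car)
qed

text \<open>The cube bound is applied to \<open>lamps A\<close> on \<open>Pow F\<close>. Vertices
  with a common neighbour differ by two flips, whence the factor 2 in the bound on lamp lengths;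
  word distance at most \<open>D\<close> allows Hamming distance at most
  \<open>M * D\<close>.\<close>

lemma controlled_dim_le_integer_wreath_product:
  fixes S and F :: "'a set"
  assumes A: "group A" and S: "S \<subseteq> carrier (wreath_product integer_group A)"
    "generate (wreath_product integer_group A) S = carrier (wreath_product integer_group A)"
    and F: "finite F" "F \<subseteq> carrier A"
    and short: "\<And>h. h \<in> F \<Longrightarrow> 2 * real (word_length (wreath_product integer_group A) S (lamps A {h})) \<le> lam"
    and M: "\<And>g. g \<in> carrier (wreath_product integer_group A) \<Longrightarrow>
       card (lamp_support A g) \<le> M * word_length (wreath_product integer_group A) S g"
    and dim: "controlled_dim_le (carrier (wreath_product integer_group A))
                (word_dist (wreath_product integer_group A) S) lam D n"
  shows "card F - nat \<lfloor>M * D\<rfloor> \<le> (n + 1) * (nat \<lfloor>M * D\<rfloor> + 1)"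
proof -
  let ?W = "wreath_product integer_group A"
  interpret W: group ?W using A by (simp add: group_wreath_product)
  interpret Metric_space "carrier ?W" "word_dist ?W S"
    using S by (rule W.Metric_space_word_dist)
  have car: "lamps A J \<in> carrier ?W" if "J \<subseteq> F" for J
    using A finite_subset[OF that F(1)] by (rule lamps_in_carrier)
  show ?thesis
  proof (rule controlled_dim_le_cube_lower_bound[OF F(1) _ _ _ _ dim])
    show "lamps A ` Pow F \<subseteq> carrier ?W" using car by auto
    show "word_dist ?W S x y = word_dist ?W S y x" for x y by (rule commute)
  next
    fix J K i j
    assume JK: "J \<subseteq> F" "K \<subseteq> F" "i \<in> F" "j \<in> F" and eq: "sym_diff J {i} = sym_diff K {j}"
    have fin: "finite J" "finite K" using JK(1,2) F(1) by (auto intro: finite_subset)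
    have sub: "sym_diff J {i} \<subseteq> F" using JK by blast
    have "word_dist ?W S (lamps A J) (lamps A K) \<le>
        word_dist ?W S (lamps A J) (lamps A (sym_diff J {i})) +
        word_dist ?W S (lamps A (sym_diff J {i})) (lamps A K)"
      by (rule triangle[OF car[OF JK(1)] car[OF sub] car[OF JK(2)]])
    \<comment> \<open>The common neighbour is reread as a flip of \<open>K\<close>, so the second
      leg is a single flip too.\<close>
    also have "word_dist ?W S (lamps A (sym_diff J {i})) (lamps A K) =
        word_dist ?W S (lamps A K) (lamps A (sym_diff K {j}))"
      unfolding eq by (rule commute)
    also have "word_dist ?W S (lamps A J) (lamps A (sym_diff J {i})) + \<dots> =
        real (word_length ?W S (lamps A {i})) + real (word_length ?W S (lamps A {j}))"
      unfolding word_dist_lamps_sym_diff_singleton[OF A fin(1) subsetD[OF F(2) JK(3)] S]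
        word_dist_lamps_sym_diff_singleton[OF A fin(2) subsetD[OF F(2) JK(4)] S] by (rule refl)
    also have "\<dots> \<le> lam" using short[OF JK(3)] short[OF JK(4)] by simp
    finally show "word_dist ?W S (lamps A J) (lamps A K) \<le> lam" .
  next
    fix J K assume JK: "J \<subseteq> F" "K \<subseteq> F" and le: "word_dist ?W S (lamps A J) (lamps A K) \<le> D"
    let ?g = "inv\<^bsub>?W\<^esub> (lamps A J) \<otimes>\<^bsub>?W\<^esub> lamps A K"
    have "card (sym_diff J K) = card (lamp_support A ?g)"
      using lamp_support_inv_lamps_mult_lamps[OF A finite_subset[OF JK(1) F(1)], of K] JK F(2) by auto
    also have "\<dots> \<le> M * word_length ?W S ?g"
      using car[OF JK(1)] car[OF JK(2)] by (intro M) simp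
    finally have "real (card (sym_diff J K)) \<le> M * real (word_length ?W S ?g)"
      by (simp flip: of_nat_mult)
    also have "\<dots> \<le> M * D"
      using le car[OF JK(1)] car[OF JK(2)] by (intro mult_left_mono) (simp_all add: word_dist_def)
    finally show "card (sym_diff J K) \<le> nat \<lfloor>M * D\<rfloor>" by (rule le_nat_floor)
  qed
qed

section \<open>Exponentially many short lamps\<close>

text \<open>The products of \<open>r\<close> factors described below are pairwise distinct, which
  yields \<open>2 ^ r\<close> positions. Reaching a position costs at most \<open>r * L\<close>,
  lighting its lamp \<open>L\<close>, and returning \<open>r * L\<close>. All lengths are measured
  in \<open>G\<close>.\<close>

lemma integer_wreath_product_exponential_growth:
  fixes S and r :: nat
  defines "H \<equiv> wreath_product integer_group integer_group"
  defines "G \<equiv> wreath_product integer_group H"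
  assumes S: "S \<subseteq> carrier G" "generate G S = carrier G"
    and L: "word_length G S (shift H (shift integer_group 1)) \<le> L"
      "word_length G S (shift H (lamps integer_group {0} \<otimes>\<^bsub>H\<^esub> shift integer_group 1)) \<le> L"
      "word_length G S (lamps H {\<one>\<^bsub>H\<^esub>}) \<le> L"
  obtains F where "finite F" "F \<subseteq> carrier H" "card F = 2 ^ r"
    "\<And>h. h \<in> F \<Longrightarrow> word_length G S (lamps H {h}) \<le> (2 * r + 1) * L"
proof -
  interpret H: group H unfolding H_def by (rule group_integer_wreath_integer)
  interpret G: group G unfolding G_def by (simp add: group_wreath_product H.group_axioms)
  \<comment> \<open>Each \<open>h r J\<close> is a product of \<open>r\<close> factors, the \<open>i\<close>-th being \<open>a t\<close> or \<open>t\<close> according to whether \<open>i \<in> J\<close>,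
    where \<open>a\<close> is the lamp at \<open>0\<close> and \<open>t\<close> the unit shift.\<close>
  define h :: "nat \<Rightarrow> int set \<Rightarrow> (int \<Rightarrow> int) \<times> int"
    where "h r J = (\<lambda>x. if x \<in> J then 1 else 0, int r)" for r J
  have h_carrier: "h r J \<in> carrier H" if "J \<subseteq> {0..<int r}" for r J
  proof -
    have "finite {x. (if x \<in> J then 1 else 0 :: int) \<noteq> 0}"
      using that by (simp add: finite_subset)
    then show ?thesis
      unfolding H_def h_def by (simp add: carrier_integer_wreath_product extensional_def)
  qed
  have gens: "shift integer_group 1 \<in> carrier H" "lamps integer_group {0} \<in> carrier H"
    unfolding H_def by (simp_all add: shift_in_carrier lamps_in_carrier)
  \<comment> \<open>With the cursor at \<open>r\<close>, the next factor sets the lamp there exactly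
    if \<open>int r\<close> lies in \<open>J\<close>, then moves on; the intersection with
    \<open>{0..<int r}\<close> is the part already written.\<close>
  have h_step: "h (Suc r) J = h r (J \<inter> {0..<int r}) \<otimes>\<^bsub>H\<^esub>
      (if int r \<in> J then lamps integer_group {0} \<otimes>\<^bsub>H\<^esub> shift integer_group 1 else shift integer_group 1)"
    if "J \<subseteq> {0..<int (Suc r)}" for r J
  proof -
    have "x \<in> {0..<int r}" if "x \<in> J" "x \<noteq> int r" for x
      using that \<open>J \<subseteq> {0..<int (Suc r)}\<close> by force
    then show ?thesis
      unfolding H_def h_def lamps_def shift_def
      by (auto simp: mult_wreath_product translation_def fun_eq_iff)
  qed
  have shift_length: "word_length G S (shift H (h r J)) \<le> r * L" if "J \<subseteq> {0..<int r}" for r J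
    using that
  proof (induction r arbitrary: J)
    case 0
    then have "h 0 J = \<one>\<^bsub>H\<^esub>" unfolding h_def H_def by (simp add: one_wreath_product fun_eq_iff)
    then have "shift H (h 0 J) = \<one>\<^bsub>G\<^esub>" unfolding G_def by (simp add: shift_one)
    then show ?case by (simp add: G.word_length_one)
  next
    case (Suc r)
    let ?x = "if int r \<in> J then lamps integer_group {0} \<otimes>\<^bsub>H\<^esub> shift integer_group 1 else shift integer_group 1"
    have x: "?x \<in> carrier H" using gens by simp
    have y: "h r (J \<inter> {0..<int r}) \<in> carrier H" by (rule h_carrier) simp
    have "shift H (h (Suc r) J) = shift H (h r (J \<inter> {0..<int r})) \<otimes>\<^bsub>G\<^esub> shift H ?x"
      unfolding h_step[OF Suc.prems] G_def by (rule shift_mult[OF H.group_axioms y, symmetric])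
    also have "word_length G S \<dots> \<le> word_length G S (shift H (h r (J \<inter> {0..<int r}))) + word_length G S (shift H ?x)"
      using shift_in_carrier[OF x] shift_in_carrier[OF y] by (intro G.word_length_mult_le[OF S]) (simp_all only: G_def)
    also have "\<dots> \<le> r * L + L"
      using L(1,2) by (intro add_mono Suc.IH) auto
    finally show ?case by simp
  qed
  show ?thesis
  proof (rule that[of "h r ` Pow {0..<int r}"])
    have "inj_on (h r) (Pow {0..<int r})"
    proof (rule inj_onI)
      fix J K assume "h r J = h r K"
      then have "(if x \<in> J then 1 else 0 :: int) = (if x \<in> K then 1 else 0)" for x
        by (simp add: h_def fun_eq_iff)
      then show "J = K" by (metis subsetI subset_antisym zero_neq_one)
    qed
    then show "card (h r ` Pow {0..<int r}) = 2 ^ r" by (simp add: card_image card_Pow)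
  next
    fix x assume "x \<in> h r ` Pow {0..<int r}"
    then obtain J where J: "x = h r J" "J \<subseteq> {0..<int r}" by blast
    have x: "x \<in> carrier H" unfolding J(1) using J(2) by (rule h_carrier)
    have car: "shift H x \<in> carrier G" "lamps H {\<one>\<^bsub>H\<^esub>} \<in> carrier G"
      unfolding G_def using shift_in_carrier[OF x] lamps_in_carrier[OF H.group_axioms] by simp_all
    have "word_length G S (lamps H {x}) = word_length G S
        (shift H x \<otimes>\<^bsub>G\<^esub> lamps H {\<one>\<^bsub>H\<^esub>} \<otimes>\<^bsub>G\<^esub> inv\<^bsub>G\<^esub> (shift H x))"
      unfolding G_def by (simp add: conj_shift_lamps_one[OF H.group_axioms x])
    also have "\<dots> \<le> word_length G S (shift H x) + word_length G S (lamps H {\<one>\<^bsub>H\<^esub>})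
        + word_length G S (inv\<^bsub>G\<^esub> (shift H x))"
      using G.word_length_mult_le[OF S, of "shift H x \<otimes>\<^bsub>G\<^esub> lamps H {\<one>\<^bsub>H\<^esub>}" "inv\<^bsub>G\<^esub> (shift H x)"]
        G.word_length_mult_le[OF S car] car by simp
    also have "\<dots> \<le> r * L + L + r * L"
      using shift_length[OF J(2)] L(3) unfolding J(1)[symmetric] G.word_length_inv[OF S car(1)]
      by (intro add_mono)
    finally show "word_length G S (lamps H {x}) \<le> (2 * r + 1) * L" by (simp add: algebra_simps)
  qed (use h_carrier in auto)
qed

section \<open>Dimension growth\<close>

text \<open>With \<open>D = exp (\<alpha> * lam)\<close>, the cube has about \<open>D * D\<close>
  coordinates while clusters have Hamming radius at most of order \<open>D\<close>, so the number of
  colours is at least of order \<open>D\<close>.\<close>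

lemma controlled_dim_Z_wr_Z_wr_Z_lower_bound:
  assumes S: "finite S" "S \<subseteq> carrier Z_wr_Z_wr_Z" "generate Z_wr_Z_wr_Z S = carrier Z_wr_Z_wr_Z"
  obtains \<alpha> K :: real where "0 < \<alpha>" "0 < K"
    "\<And>lam n. 0 < lam \<Longrightarrow>
       controlled_dim_le (carrier Z_wr_Z_wr_Z) (word_dist Z_wr_Z_wr_Z S) lam (exp (\<alpha> * lam)) n \<Longrightarrow>
       K * exp (\<alpha> * lam) \<le> real n + 2"
proof -
  let ?H = "wreath_product integer_group integer_group"
  interpret H: group ?H by (rule group_integer_wreath_integer)
  \<comment> \<open>A common bound for the three lengths; \<open>Suc\<close> keeps it positive for
    the divisions below.\<close>
  define L where "L = Suc (word_length Z_wr_Z_wr_Z S (shift ?H (shift integer_group 1)) +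
      word_length Z_wr_Z_wr_Z S (shift ?H (lamps integer_group {0} \<otimes>\<^bsub>?H\<^esub> shift integer_group 1)) +
      word_length Z_wr_Z_wr_Z S (lamps ?H {\<one>\<^bsub>?H\<^esub>}))"
  have L: "0 < L" by (simp add: L_def)
  have L_bounds: "word_length Z_wr_Z_wr_Z S (shift ?H (shift integer_group 1)) \<le> L"
    "word_length Z_wr_Z_wr_Z S (shift ?H (lamps integer_group {0} \<otimes>\<^bsub>?H\<^esub> shift integer_group 1)) \<le> L"
    "word_length Z_wr_Z_wr_Z S (lamps ?H {\<one>\<^bsub>?H\<^esub>}) \<le> L"
    unfolding L_def by linarith+
  obtain M where M: "\<And>g. g \<in> carrier Z_wr_Z_wr_Z \<Longrightarrow>
      card (lamp_support ?H g) \<le> M * word_length Z_wr_Z_wr_Z S g"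
    using card_lamp_support_le_word_length[OF H.group_axioms S(2,3,1)] by blast
  \<comment> \<open>The largest admissible \<open>r\<close> is about \<open>lam / (4 * L)\<close>.
    This choice makes the square of \<open>exp (\<alpha> * lam)\<close> equal to
    \<open>2 powr (lam / (4 * L))\<close>, which is \<open>2 ^ r\<close> up to a constant
    factor.\<close>
  define \<alpha> where "\<alpha> = ln 2 / (8 * real L)"
  \<comment> \<open>The 4 pays for rounding \<open>r\<close> down by at most 2, and
    \<open>M + 1\<close> for the bound on \<open>k + 1\<close>.\<close>
  define K where "K = 1 / (4 * (real M + 1))"
  have K: "0 < K" by (simp add: K_def)
  show ?thesis
  proof (rule that[of \<alpha> K])
    show "0 < \<alpha>" using L by (simp add: \<alpha>_def)
  next
    fix lam n
    let ?D = "exp (\<alpha> * lam)"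
    assume lam: "0 < lam" and dim: "controlled_dim_le (carrier Z_wr_Z_wr_Z) (word_dist Z_wr_Z_wr_Z S) lam ?D n"
    have D1: "1 \<le> ?D" using lam L by (simp add: \<alpha>_def)
    have D_powr: "?D * ?D = 2 powr (lam / (4 * L))"
      using L by (simp add: \<alpha>_def powr_def exp_add[symmetric] field_simps)
    show "K * ?D \<le> real n + 2"
    \<comment> \<open>Below \<open>2 * L\<close> even \<open>r = 0\<close> violates the length
      condition, but there \<open>?D\<close> is at most 2 and the claim is immediate.\<close>
    proof (cases "lam < 2 * L")
      case True
      then have "ln 2 * lam \<le> ln 2 * (8 * L)" using L by (intro mult_left_mono) auto
      then have "\<alpha> * lam \<le> ln 2" using L by (simp add: \<alpha>_def field_simps)
      then have "?D \<le> exp (ln 2)" by (simp only: exp_le_cancel_iff)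
      then have "K * ?D \<le> K * 2" using K by simp
      also have "\<dots> \<le> 2" by (simp add: K_def field_simps)
      finally show ?thesis by simp
    next
      case False
      \<comment> \<open>The largest \<open>r\<close> with
        \<open>2 * (2 * r + 1) * L \<le> lam\<close>.\<close>
      define r where "r = nat \<lfloor>lam / (4 * L) - 1 / 2\<rfloor>"
      have "0 \<le> lam / (4 * L) - 1 / 2" using False L by (simp add: field_simps)
      then have r: "real r \<le> lam / (4 * L) - 1 / 2" "lam / (4 * L) - 2 \<le> real r"
        unfolding r_def by linarith+
      have short: "2 * real ((2 * r + 1) * L) \<le> lam"
        using r(1) L by (simp add: field_simps)
      obtain F where F: "finite F" "F \<subseteq> carrier ?H" "card F = 2 ^ r"
        "\<And>h. h \<in> F \<Longrightarrow> word_length Z_wr_Z_wr_Z S (lamps ?H {h}) \<le> (2 * r + 1) * L"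
        using integer_wreath_product_exponential_growth[OF S(2,3) L_bounds] by blast
      define k where "k = nat \<lfloor>M * ?D\<rfloor>"
      have k: "real k + 1 \<le> (real M + 1) * ?D"
      proof -
        have "real k \<le> real M * ?D" unfolding k_def by (rule of_nat_floor) simp
        then show ?thesis using D1 unfolding distrib_right by linarith
      qed
      have "2 * real (word_length Z_wr_Z_wr_Z S (lamps ?H {h})) \<le> lam" if "h \<in> F" for h
        using F(4)[OF that] short by (meson mult_left_mono of_nat_mono order_trans zero_le_numeral)
      then have "card F - k \<le> (n + 1) * (k + 1)"
        unfolding k_def by (rule controlled_dim_le_integer_wreath_product[OF H.group_axioms S(2,3) F(1,2) _ M dim])
      \<comment> \<open>Moving the truncated \<open>k\<close> to the right costs less than one
        further \<open>k + 1\<close>; this turns \<open>n + 1\<close> into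
        \<open>n + 2\<close>.\<close>
      then have "2 ^ r \<le> (n + 2) * (k + 1)"
        unfolding F(3) by (simp add: algebra_simps)
      then have "real (2 ^ r) \<le> real ((n + 2) * (k + 1))" by (simp only: of_nat_le_iff)
      then have "(2::real) ^ r \<le> (real n + 2) * (real k + 1)" by (simp add: algebra_simps)
      also have "\<dots> \<le> (real n + 2) * ((real M + 1) * ?D)"
        using k by (intro mult_left_mono) simp_all
      finally have "(2::real) ^ r \<le> (real n + 2) * (real M + 1) * ?D" by simp
      moreover have "?D * ?D / 4 \<le> 2 ^ r"
      proof -
        have "?D * ?D / 4 = 2 powr (lam / (4 * L) - 2)" by (simp add: D_powr powr_diff)
        also have "\<dots> \<le> 2 powr real r" using r(2) by (intro powr_mono) simp_all
        finally show ?thesis by (simp add: powr_realpow)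
      qed
      \<comment> \<open>One factor \<open>?D\<close> cancels against the cluster radius; the other
        remains as the bound.\<close>
      ultimately have "?D / 4 * ?D \<le> (real n + 2) * (real M + 1) * ?D" by linarith
      then have "?D / 4 \<le> (real n + 2) * (real M + 1)"
        by (rule mult_right_le_imp_le) simp
      then show ?thesis by (simp add: K_def field_simps)
    qed
  qed (rule K)
qed

section \<open>From exponential bounds to equal growth\<close>

text \<open>\<open>same_growth\<close> permits rescaling of the argument and an additive error, but
  no factor. The factor \<open>K\<close> is absorbed by doubling the exponent.\<close>

lemma same_growth_exp:
  fixes N :: "real \<Rightarrow> nat" and \<alpha> \<beta> K c :: real
  assumes pos: "0 < \<alpha>" "0 < K" "0 \<le> c"
    and lower: "\<And>t. 0 < t \<Longrightarrow> K * exp (\<alpha> * t) \<le> real (N t) + c"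
    and upper: "\<And>t. 0 < t \<Longrightarrow> real (N t) \<le> exp (\<beta> * t)"
  shows "same_growth (\<lambda>t. ereal (real (N t))) (\<lambda>t. ereal (exp t))"
proof -
  \<comment> \<open>\<open>2 / \<alpha>\<close> doubles the exponent in the lower bound;
    \<open>\<beta>\<close> makes \<open>exp (a * t)\<close> dominate the upper bound.\<close>
  define a where "a = max (2 / \<alpha>) \<beta>"
  define b where "b = c + 1 / (4 * K)"
  have a: "0 < a" "2 / \<alpha> \<le> a" "\<beta> \<le> a" using pos(1) by (auto simp: a_def less_max_iff_disj)
  have b: "0 < b" using pos(2,3) by (simp add: b_def add_nonneg_pos)
  have lo: "exp t - b \<le> real (N (a * t))" if t: "0 < t" for t
  proof -
    \<comment> \<open>Completing the square gives \<open>x - 1 / (4 * K) \<le> K * x * x\<close> for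
      \<open>x = exp t\<close>, which explains the second summand of \<open>b\<close>.\<close>
    have "0 \<le> (2 * K * exp t - 1)\<^sup>2 / (4 * K)" using pos(2) by simp
    also have "\<dots> = K * (exp t * exp t) - exp t + 1 / (4 * K)"
      using pos(2) by (simp add: power2_eq_square field_simps)
    finally have "exp t - 1 / (4 * K) \<le> K * (exp t * exp t)" by linarith
    also have "exp t * exp t = exp (2 * t)" by (simp add: exp_add[symmetric])
    also have "K * exp (2 * t) \<le> K * exp (\<alpha> * (a * t))"
    proof -
      have "2 \<le> \<alpha> * a" using a(2) pos(1) by (simp add: field_simps)
      then have "2 * t \<le> \<alpha> * a * t" using t by (intro mult_right_mono) auto
      then show ?thesis using pos(2) by (simp add: mult.assoc)
    qed
    also have "\<dots> \<le> real (N (a * t)) + c" using a(1) t by (intro lower) simp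
    finally show ?thesis by (simp add: b_def)
  qed
  have up: "real (N t) - b \<le> exp (a * t)" if t: "0 < t" for t
  proof -
    have "\<beta> * t \<le> a * t" using a(3) t by (intro mult_right_mono) auto
    then have "exp (\<beta> * t) \<le> exp (a * t)" by simp
    then show ?thesis using upper[OF t] b by linarith
  qed
  show ?thesis
    unfolding same_growth_def using a(1) b lo up
    by (intro exI[of _ a] exI[of _ b] conjI allI impI) simp_all
qed

text \<open>An infimum of a nonempty set in \<open>enat\<close> is attained, so a finite dimension
  comes with a colouring realising it.\<close>

lemma controlled_dim_eq_enat:
  assumes "controlled_dim_le X d lam D m"
  obtains n where "controlled_dim X d lam D = enat n" "controlled_dim_le X d lam D n" "n \<le> m"
proof -
  let ?A = "{enat n |n. controlled_dim_le X d lam D n}"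
  have m: "enat m \<in> ?A" using assms by blast
  then have "Inf ?A \<in> ?A" by (rule wellorder_InfI)
  then obtain n where n: "Inf ?A = enat n" "controlled_dim_le X d lam D n" by blast
  moreover have "Inf ?A \<le> enat m" using m by (rule Inf_lower)
  ultimately show ?thesis using that by (simp add: controlled_dim_def)
qed

theorem corollary4p8:
  shows "has_derived_length Z_wr_Z_wr_Z 3 \<and>
    (\<forall>S. finite S \<and> S \<subseteq> carrier Z_wr_Z_wr_Z \<and> generate Z_wr_Z_wr_Z S = carrier Z_wr_Z_wr_Z \<longrightarrow>
      (\<exists>\<alpha>>0. same_growth
         (\<lambda>lam. ereal_of_enat (dim_growth_fun (\<lambda>t. exp (\<alpha> * t))
                   (carrier Z_wr_Z_wr_Z) (word_dist Z_wr_Z_wr_Z S) lam))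
         (\<lambda>lam. ereal (exp lam))))"
proof (intro conjI allI impI has_derived_length_Z_wr_Z_wr_Z)
  let ?G = Z_wr_Z_wr_Z
  fix S
  assume "finite S \<and> S \<subseteq> carrier ?G \<and> generate ?G S = carrier ?G"
  then have S: "finite S" "S \<subseteq> carrier ?G" "generate ?G S = carrier ?G" by blast+
  interpret G: group ?G by (intro group_wreath_product group_integer_wreath_integer group_integer_group)
  obtain \<alpha> K where pos: "0 < \<alpha>" "0 < K" and lower: "\<And>lam n. 0 < lam \<Longrightarrow>
      controlled_dim_le (carrier ?G) (word_dist ?G S) lam (exp (\<alpha> * lam)) n \<Longrightarrow>
      K * exp (\<alpha> * lam) \<le> real n + 2"
    using controlled_dim_Z_wr_Z_wr_Z_lower_bound[OF S] by blast
  let ?dim = "\<lambda>lam. dim_growth_fun (\<lambda>t. exp (\<alpha> * t)) (carrier ?G) (word_dist ?G S) lam"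
  \<comment> \<open>The base of the word count; being at least 1, it makes powers of
    \<open>m\<close> monotone in the exponent.\<close>
  define m where "m = card (S \<union> m_inv ?G ` S) + 1"
  have "\<exists>n. ?dim lam = enat n \<and>
      controlled_dim_le (carrier ?G) (word_dist ?G S) lam (exp (\<alpha> * lam)) n \<and> n \<le> m ^ nat \<lfloor>lam\<rfloor>" for lam
    using controlled_dim_eq_enat[OF G.controlled_dim_le_word_dist[OF S(2,3,1) exp_ge_zero]]
    unfolding m_def dim_growth_fun_def by metis
  then obtain N where N: "\<And>lam. ?dim lam = enat (N lam)"
    "\<And>lam. controlled_dim_le (carrier ?G) (word_dist ?G S) lam (exp (\<alpha> * lam)) (N lam)"
    "\<And>lam. N lam \<le> m ^ nat \<lfloor>lam\<rfloor>" by metis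
  have "same_growth (\<lambda>lam. ereal (real (N lam))) (\<lambda>lam. ereal (exp lam))"
  \<comment> \<open>The 2 is the summand in \<open>real n + 2\<close> of the lower bound; the upper
    exponent is \<open>ln (real m)\<close>.\<close>
  proof (rule same_growth_exp[OF pos, of 2])
    show "real (N t) \<le> exp (ln (real m) * t)" if "0 < t" for t
    proof -
      have "real (N t) \<le> real m ^ nat \<lfloor>t\<rfloor>"
        using N(3)[of t] by (metis of_nat_le_iff of_nat_power)
      also have "\<dots> = real m powr real (nat \<lfloor>t\<rfloor>)" by (simp add: m_def powr_realpow)
      also have "\<dots> \<le> real m powr t" using that by (intro powr_mono) (auto simp: m_def)
      finally show ?thesis by (simp add: m_def powr_def mult.commute)
    qed
  qed (use lower N(2) in auto)
  then show "\<exists>\<alpha>>0. same_growth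
         (\<lambda>lam. ereal_of_enat (dim_growth_fun (\<lambda>t. exp (\<alpha> * t))
                   (carrier ?G) (word_dist ?G S) lam))
         (\<lambda>lam. ereal (exp lam))"
    using pos(1) by (intro exI[of _ \<alpha>]) (simp add: N(1))
qed

end
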